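(* Let $R$ be a subring of $\mathbb{C}$ (with $1\in R$) that is closed under complex conjugation. Then the following are equivalent. \begin{enumerate} \item[(1)] For every $n\geq 1$, if $v\in R^n$ is a unit vector, then $v$ has exactly one nonzero entry; i.e., if $r_1,\ldots,r_n\in R$ and $1=\sum_{i=1}^n|r_i|^2$, then only one $r_i$ is nonzero. \item[(2)] For every $n\geq 1$ and all $r_1,\ldots,r_n\in R$, if $r_1=\sum_{i=1}^n |r_i|^2$, then $r_2=\cdots=r_n=0$. \item[(3)] If $\mathscr{G}$ is a Hausdorff ample groupoid, then each projection in $R\mathscr{G}$ belongs to the diagonal subalgebra $D(R\mathscr{G})$. \item[(4)] For all Hausdorff ample groupoids $\mathscr{G}$ and $\mathscr{H}$, every $\ast$-homomorphism $R\mathscr{G}\to R\mathscr{H}$ is diagonal preserving. \item[(5)] For all Hausdorff ample groupoids $\mathscr{G}$ and $\mathscr{H}$, every $\ast$-isomorphism $R\mathscr{G}\to R\mathscr{H}$ is diagonal preserving. \item[(6)] For every $n\geq 1$, every unitary matrix in $GL_n(R)$ is monomial, i.e., has exactly one nonzero entry in every row and every column. \end{enumerate}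
   Context: Rings are unital; $|\cdot|$ is the usual complex absolute value. A vector $v=(r_1,\ldots,r_n)\in R^n\subseteq\mathbb{C}^n$ is a unit vector if $\sum_{i=1}^n|r_i|^2=1$. A matrix $U\in GL_n(R)$ is unitary if $UU^*=U^*U=I$, where $U^*$ is the conjugate transpose. Groupoids. Objects of a groupoid are identified with identity arrows; $\mathscr{G}^{(0)}$ denotes the unit space of a groupoid $\mathscr{G}$, and $\boldsymbol{d},\boldsymbol{r}\colon \mathscr{G}\to\mathscr{G}^{(0)}$ denote the domain (source) and range maps; the product $\alpha\beta$ is defined when $\boldsymbol{d}(\alpha)=\boldsymbol{r}(\beta)$. An ample groupoid is a topological groupoid $\mathscr{G}$ whose unit space $\mathscr{G}^{(0)}$ is locally compact, Hausdorff and totally disconnected and whose range map $\boldsymbol{r}\colon\mathscr{G}\to\mathscr{G}^{(0)}$ is a local homeomorphism. It is a Hausdorff ample groupoid if moreover the space $\mathscr{G}$ is Hausdorff; in that case $\mathscr{G}^{(0)}$ is clopen in $\mathscr{G}$. Groupoid algebra. For a Hausdorff ample groupoid $\mathscr{G}$, $R\mathscr{G}$ is the $R$-algebra (not necessarily unital) of compactly supported locally constant functions $f\colon\mathscr{G}\to R$ with pointwise addition and scalar multiplication and with convolution product \[ (f\ast g)(\gamma)=\sum_{\boldsymbol{r}(\alpha)=\boldsymbol{r}(\gamma)}f(\alpha)g(\alpha^{-1}\gamma). \] It carries the involution $f^*(\gamma)=\overline{f(\gamma^{-1})}$ (which maps $R\mathscr{G}$ to itself because $R$ is closed under complex conjugation).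 A projection in $R\mathscr{G}$ is an element $f$ with $f=f^*=f\ast f$. A $\ast$-homomorphism $\varphi\colon R\mathscr{G}\to R\mathscr{H}$ is an $R$-algebra homomorphism (not required to preserve units) with $\varphi(f^* )=\varphi(f)^*$ for all $f$; a $\ast$-isomorphism is a bijective $\ast$-homomorphism. Diagonal. The diagonal subalgebra $D(R\mathscr{G})$ is the subalgebra of $R\mathscr{G}$ consisting of the functions supported on $\mathscr{G}^{(0)}$. A homomorphism $\varphi\colon R\mathscr{G}\to R\mathscr{H}$ is diagonal preserving if $\varphi(D(R\mathscr{G}))\subseteq D(R\mathscr{H})$. An isomorphism $\varphi$ is called a diagonal preserving isomorphism if both $\varphi$ and $\varphi^{-1}$ are diagonal preserving, equivalently if $\varphi(D(R\mathscr{G}))=D(R\mathscr{H})$. *)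

theory Defs
  imports
    "HOL-Analysis.Abstract_Topological_Spaces"
    "Jordan_Normal_Form.Schur_Decomposition"
begin

text \<open>
  Subrings of the complex numbers (unital, with the same unit) closed under conjugation.
\<close>

definition conj_closed_subring :: "complex set \<Rightarrow> bool" where
  "conj_closed_subring R \<longleftrightarrow>
     1 \<in> R \<and>
     (\<forall>x\<in>R. \<forall>y\<in>R. x - y \<in> R) \<and>
     (\<forall>x\<in>R. \<forall>y\<in>R. x * y \<in> R) \<and>
     (\<forall>x\<in>R. cnj x \<in> R)"


section \<open>Topological groupoids\<close>

text \<open>
  The set of arrows is the carrier \<^term>\<open>topspace T\<close> of the topology \<open>T\<close> on the groupoid;
  objects are identified with identity arrows. The values of the structure maps matter only
  on arrows (for the product: on composable pairs).

  HOL formulas cannot quantify over types, so ``all groupoids'' ranges over the groupoids carried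
  by subsets of a type \<open>'g\<close>, with \<open>'g\<close> an arbitrary infinite type. Every groupoid embeds in some
  such type, and every finite groupoid in each of them; a type that is too small would make the
  conditions on groupoids hold trivially.
\<close>

record 'g groupoid =
  gtop  :: "'g topology"
  gdom  :: "'g \<Rightarrow> 'g"
  gran  :: "'g \<Rightarrow> 'g"
  gmult :: "'g \<Rightarrow> 'g \<Rightarrow> 'g"
  ginv  :: "'g \<Rightarrow> 'g"

definition arrows :: "'g groupoid \<Rightarrow> 'g set" where
  "arrows G = topspace (gtop G)"

definition unit_space :: "'g groupoid \<Rightarrow> 'g set" where
  "unit_space G = gdom G ` arrows G"

definition unit_top :: "'g groupoid \<Rightarrow> 'g topology" where
  "unit_top G = subtopology (gtop G) (unit_space G)"

definition composable :: "'g groupoid \<Rightarrow> ('g \<times> 'g) set" where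
  "composable G = {(a, b). a \<in> arrows G \<and> b \<in> arrows G \<and> gdom G a = gran G b}"

definition is_groupoid :: "'g groupoid \<Rightarrow> bool" where
  "is_groupoid G \<longleftrightarrow>
     (\<forall>a\<in>arrows G. gdom G a \<in> arrows G \<and> gran G a \<in> arrows G \<and> ginv G a \<in> arrows G) \<and>
     (\<forall>a\<in>arrows G. gdom G (gdom G a) = gdom G a \<and> gran G (gdom G a) = gdom G a \<and>
                    gdom G (gran G a) = gran G a \<and> gran G (gran G a) = gran G a) \<and>
     (\<forall>(a, b)\<in>composable G. gmult G a b \<in> arrows G \<and>
        gdom G (gmult G a b) = gdom G b \<and> gran G (gmult G a b) = gran G a) \<and>
     (\<forall>a b c. (a, b) \<in> composable G \<and> (b, c) \<in> composable G \<longrightarrow>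
        gmult G (gmult G a b) c = gmult G a (gmult G b c)) \<and>
     (\<forall>a\<in>arrows G. gmult G (gran G a) a = a \<and> gmult G a (gdom G a) = a) \<and>
     (\<forall>a\<in>arrows G. gdom G (ginv G a) = gran G a \<and> gran G (ginv G a) = gdom G a \<and>
        gmult G a (ginv G a) = gran G a \<and> gmult G (ginv G a) a = gdom G a)"

text \<open>
  Continuity of the domain and range maps follows from that of product and inverse.
\<close>

definition topological_groupoid :: "'g groupoid \<Rightarrow> bool" where
  "topological_groupoid G \<longleftrightarrow>
     is_groupoid G \<and>
     continuous_map (subtopology (prod_topology (gtop G) (gtop G)) (composable G)) (gtop G)
       (\<lambda>(a, b). gmult G a b) \<and>
     continuous_map (gtop G) (gtop G) (ginv G)"

definition local_homeomorphism :: "'a topology \<Rightarrow> 'b topology \<Rightarrow> ('a \<Rightarrow> 'b) \<Rightarrow> bool" where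
  "local_homeomorphism X Y f \<longleftrightarrow>
     (\<forall>x\<in>topspace X. \<exists>U. openin X U \<and> x \<in> U \<and> openin Y (f ` U) \<and>
        homeomorphic_map (subtopology X U) (subtopology Y (f ` U)) f)"

definition totally_disconnected_space :: "'a topology \<Rightarrow> bool" where
  "totally_disconnected_space X \<longleftrightarrow>
     (\<forall>S. connectedin X S \<longrightarrow> (\<forall>x\<in>S. \<forall>y\<in>S. x = y))"

definition ample_groupoid :: "'g groupoid \<Rightarrow> bool" where
  "ample_groupoid G \<longleftrightarrow>
     topological_groupoid G \<and>
     locally_compact_space (unit_top G) \<and>
     Hausdorff_space (unit_top G) \<and>
     totally_disconnected_space (unit_top G) \<and>
     local_homeomorphism (gtop G) (unit_top G) (gran G)"

definition hausdorff_ample_groupoid :: "'g groupoid \<Rightarrow> bool" where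
  "hausdorff_ample_groupoid G \<longleftrightarrow> ample_groupoid G \<and> Hausdorff_space (gtop G)"


section \<open>Groupoid algebras\<close>

definition locally_constant_map :: "'a topology \<Rightarrow> ('a \<Rightarrow> 'b) \<Rightarrow> bool" where
  "locally_constant_map X f \<longleftrightarrow>
     (\<forall>x\<in>topspace X. \<exists>U. openin X U \<and> x \<in> U \<and> (\<forall>y\<in>U. f y = f x))"

text \<open>
  Functions on the groupoid are total functions on the ambient type that vanish off the arrows,
  so that equality of elements of the algebra is equality in HOL. Addition and scalar
  multiplication are the pointwise operations.
\<close>

definition groupoid_algebra :: "complex set \<Rightarrow> 'g groupoid \<Rightarrow> ('g \<Rightarrow> complex) set" where
  "groupoid_algebra R G =
     {f. (\<forall>x\<in>arrows G. f x \<in> R) \<and> (\<forall>x. x \<notin> arrows G \<longrightarrow> f x = 0) \<and>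
         locally_constant_map (gtop G) f \<and>
         compactin (gtop G) (gtop G closure_of {x \<in> arrows G. f x \<noteq> 0})}"

text \<open>
  The range fibre may be infinite, but a compactly supported \<open>f\<close> is nonzero at only finitely many
  of its points. The restriction to \<open>f \<alpha> \<noteq> 0\<close> is needed because HOL sums over infinite index sets
  are \<open>0\<close>.
\<close>

definition conv :: "'g groupoid \<Rightarrow> ('g \<Rightarrow> complex) \<Rightarrow> ('g \<Rightarrow> complex) \<Rightarrow> 'g \<Rightarrow> complex" where
  "conv G f g = (\<lambda>\<gamma>. if \<gamma> \<in> arrows G
     then \<Sum>\<alpha> | \<alpha> \<in> arrows G \<and> gran G \<alpha> = gran G \<gamma> \<and> f \<alpha> \<noteq> 0. f \<alpha> * g (gmult G (ginv G \<alpha>) \<gamma>)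
     else 0)"

definition star :: "'g groupoid \<Rightarrow> ('g \<Rightarrow> complex) \<Rightarrow> 'g \<Rightarrow> complex" where
  "star G f = (\<lambda>\<gamma>. if \<gamma> \<in> arrows G then cnj (f (ginv G \<gamma>)) else 0)"

definition projection :: "complex set \<Rightarrow> 'g groupoid \<Rightarrow> ('g \<Rightarrow> complex) \<Rightarrow> bool" where
  "projection R G f \<longleftrightarrow> f \<in> groupoid_algebra R G \<and> f = star G f \<and> f = conv G f f"

definition diagonal :: "complex set \<Rightarrow> 'g groupoid \<Rightarrow> ('g \<Rightarrow> complex) set" where
  "diagonal R G = {f \<in> groupoid_algebra R G. \<forall>x. f x \<noteq> 0 \<longrightarrow> x \<in> unit_space G}"

definition star_hom ::
  "complex set \<Rightarrow> 'g groupoid \<Rightarrow> 'h groupoid \<Rightarrow> (('g \<Rightarrow> complex) \<Rightarrow> 'h \<Rightarrow> complex) \<Rightarrow> bool" where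
  "star_hom R G H \<phi> \<longleftrightarrow>
     (\<forall>f\<in>groupoid_algebra R G. \<phi> f \<in> groupoid_algebra R H) \<and>
     (\<forall>f\<in>groupoid_algebra R G. \<forall>g\<in>groupoid_algebra R G.
        \<phi> (\<lambda>x. f x + g x) = (\<lambda>y. \<phi> f y + \<phi> g y)) \<and>
     (\<forall>c\<in>R. \<forall>f\<in>groupoid_algebra R G. \<phi> (\<lambda>x. c * f x) = (\<lambda>y. c * \<phi> f y)) \<and>
     (\<forall>f\<in>groupoid_algebra R G. \<forall>g\<in>groupoid_algebra R G. \<phi> (conv G f g) = conv H (\<phi> f) (\<phi> g)) \<and>
     (\<forall>f\<in>groupoid_algebra R G. \<phi> (star G f) = star H (\<phi> f))"

definition star_iso ::
  "complex set \<Rightarrow> 'g groupoid \<Rightarrow> 'h groupoid \<Rightarrow> (('g \<Rightarrow> complex) \<Rightarrow> 'h \<Rightarrow> complex) \<Rightarrow> bool" where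
  "star_iso R G H \<phi> \<longleftrightarrow>
     star_hom R G H \<phi> \<and> bij_betw \<phi> (groupoid_algebra R G) (groupoid_algebra R H)"

definition diagonal_preserving ::
  "complex set \<Rightarrow> 'g groupoid \<Rightarrow> 'h groupoid \<Rightarrow> (('g \<Rightarrow> complex) \<Rightarrow> 'h \<Rightarrow> complex) \<Rightarrow> bool" where
  "diagonal_preserving R G H \<phi> \<longleftrightarrow> \<phi> ` diagonal R G \<subseteq> diagonal R H"

definition diagonal_preserving_iso ::
  "complex set \<Rightarrow> 'g groupoid \<Rightarrow> 'h groupoid \<Rightarrow> (('g \<Rightarrow> complex) \<Rightarrow> 'h \<Rightarrow> complex) \<Rightarrow> bool" where
  "diagonal_preserving_iso R G H \<phi> \<longleftrightarrow>
     diagonal_preserving R G H \<phi> \<and>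
     diagonal_preserving R H G (inv_into (groupoid_algebra R G) \<phi>)"


section \<open>Matrices over a subring\<close>

definition GL_over :: "complex set \<Rightarrow> nat \<Rightarrow> complex mat set" where
  "GL_over R n =
     {U \<in> carrier_mat n n. elements_mat U \<subseteq> R \<and>
        (\<exists>V\<in>carrier_mat n n. elements_mat V \<subseteq> R \<and> U * V = 1\<^sub>m n \<and> V * U = 1\<^sub>m n)}"

text \<open>\<^const>\<open>mat_adjoint\<close> is the conjugate transpose.\<close>

definition unitary_mat :: "nat \<Rightarrow> complex mat \<Rightarrow> bool" where
  "unitary_mat n U \<longleftrightarrow> U * mat_adjoint U = 1\<^sub>m n \<and> mat_adjoint U * U = 1\<^sub>m n"

definition monomial_mat :: "nat \<Rightarrow> complex mat \<Rightarrow> bool" where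
  "monomial_mat n U \<longleftrightarrow>
     (\<forall>i<n. \<exists>!j. j < n \<and> U $$ (i, j) \<noteq> 0) \<and>
     (\<forall>j<n. \<exists>!i. i < n \<and> U $$ (i, j) \<noteq> 0)"


section \<open>Equivalence of a list of conditions\<close>

definition all_equivalent :: "bool list \<Rightarrow> bool" where
  "all_equivalent Ps \<longleftrightarrow> (\<forall>P\<in>set Ps. \<forall>Q\<in>set Ps. P \<longleftrightarrow> Q)"

end

theory Submission
  imports Defs
begin

text \<open>
  If \<open>r\<^sub>1 = \<Sum>|r\<^sub>i|\<^sup>2\<close>, then \<open>(1 - 2r\<^sub>1, 2r\<^sub>2, \<dots>, 2r\<^sub>n)\<close> is a unit vector, and conversely a unit vector \<open>v\<close>
  yields the projection \<open>v v\<^sup>*\<close>, whose rows satisfy the hypothesis of (2), and the unitary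
  \<open>1 - 2 v v\<^sup>*\<close>; the only obstruction, \<open>1/2 \<in> R\<close>, is excluded by the vector \<open>(1/2, 1/2, 1/2, 1/2)\<close>.
  This gives the equivalence of (1), (2) and (6).

  A projection \<open>f\<close> of a groupoid algebra satisfies \<open>f x = \<Sum>|f \<alpha>|\<^sup>2\<close> at a unit \<open>x\<close>, where \<open>\<alpha>\<close> runs
  through the arrows with range \<open>x\<close>, so (2) forces \<open>f\<close> to vanish off the units. The diagonal
  subalgebra is spanned by the indicator functions of compact open sets of units, which are
  projections, hence (4); the inverse of a \<open>*\<close>-isomorphism is a \<open>*\<close>-homomorphism because the
  groupoid algebra is closed under convolution, hence (5).

  Conversely, the algebra of the pair groupoid on \<open>n\<close> points is the algebra of \<open>n \<times> n\<close> matrices.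
  There (3) applies to \<open>v v\<^sup>*\<close>, and (4) and (5) apply to conjugation by a unitary \<open>U\<close>, which
  preserves the diagonal only if \<open>U\<close> is monomial.
\<close>

section \<open>Closure properties of the coefficient ring\<close>

text \<open>The definition supplies only differences, so \<open>0\<close> arises as
  \<open>x - x\<close> and sums as \<open>x - (0 - y)\<close>. The last clause covers infinite
  \<open>A\<close> too, since such a sum is \<open>0\<close> in HOL.\<close>

lemma conj_closed_subring_closed:
  assumes R: "conj_closed_subring R"
  shows "1 \<in> R" "0 \<in> R"
    "\<And>x y. x \<in> R \<Longrightarrow> y \<in> R \<Longrightarrow> x - y \<in> R"
    "\<And>x y. x \<in> R \<Longrightarrow> y \<in> R \<Longrightarrow> x + y \<in> R"
    "\<And>x y. x \<in> R \<Longrightarrow> y \<in> R \<Longrightarrow> x * y \<in> R"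
    "\<And>x. x \<in> R \<Longrightarrow> cnj x \<in> R"
    "\<And>A g. (\<And>a. a \<in> A \<Longrightarrow> g a \<in> R) \<Longrightarrow> (\<Sum>a\<in>A. g a) \<in> R"
proof -
  show "1 \<in> R" and diff: "\<And>x y. x \<in> R \<Longrightarrow> y \<in> R \<Longrightarrow> x - y \<in> R"
    and "\<And>x y. x \<in> R \<Longrightarrow> y \<in> R \<Longrightarrow> x * y \<in> R" "\<And>x. x \<in> R \<Longrightarrow> cnj x \<in> R"
    using R by (auto simp: conj_closed_subring_def)
  then show zero: "0 \<in> R"
    by (metis diff_self)
  show add: "x + y \<in> R" if "x \<in> R" "y \<in> R" for x y
    using diff[OF that(1) diff[OF zero that(2)]] by simp
  show "(\<Sum>a\<in>A. g a) \<in> R" if "\<And>a. a \<in> A \<Longrightarrow> g a \<in> R" for A and g :: "'b \<Rightarrow> complex"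
    using that by (induction A rule: infinite_finite_induct) (auto simp: zero intro: add)
qed

section \<open>Unit vectors and unitary matrices over a subring\<close>

text \<open>This predicate and the next two repeat the three conditions on vectors and matrices
  verbatim, so that unfolding them at the very end yields the statement of the theorem.\<close>

definition unit_vectors_trivial :: "complex set \<Rightarrow> bool" where
  "unit_vectors_trivial R \<longleftrightarrow>
     (\<forall>n\<ge>1. \<forall>r :: nat \<Rightarrow> complex. (\<forall>i\<in>{1..n}. r i \<in> R) \<and> (\<Sum>i=1..n. (cmod (r i))\<^sup>2) = 1 \<longrightarrow>
       (\<exists>!i. i \<in> {1..n} \<and> r i \<noteq> 0))"

definition projection_rows_trivial :: "complex set \<Rightarrow> bool" where
  "projection_rows_trivial R \<longleftrightarrow>
     (\<forall>n\<ge>1. \<forall>r :: nat \<Rightarrow> complex. (\<forall>i\<in>{1..n}. r i \<in> R) \<and>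
       r 1 = complex_of_real (\<Sum>i=1..n. (cmod (r i))\<^sup>2) \<longrightarrow> (\<forall>i\<in>{2..n}. r i = 0))"

definition unitaries_monomial :: "complex set \<Rightarrow> bool" where
  "unitaries_monomial R \<longleftrightarrow> (\<forall>n\<ge>1. \<forall>U\<in>GL_over R n. unitary_mat n U \<longrightarrow> monomial_mat n U)"

text \<open>Transports the condition to an arbitrary finite index set along an enumeration starting
  at 1. The set is nonempty because an empty sum cannot be 1.\<close>

lemma unit_vectors_trivial_ex1:
  assumes R: "unit_vectors_trivial R" and "finite S"
    and f: "\<And>s. s \<in> S \<Longrightarrow> f s \<in> R" and unit: "(\<Sum>s\<in>S. (cmod (f s))\<^sup>2) = 1"
  shows "\<exists>!s. s \<in> S \<and> f s \<noteq> 0"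
proof -
  obtain h where h: "bij_betw h {1..card S} S"
    using ex_bij_betw_nat_finite_1[OF \<open>finite S\<close>] by blast
  have "S \<noteq> {}" using unit by auto
  then have "card S \<ge> 1" using \<open>finite S\<close> by (simp add: Suc_leI card_gt_0_iff)
  moreover have "(\<Sum>i=1..card S. (cmod (f (h i)))\<^sup>2) = 1"
    using sum.reindex_bij_betw[OF h, of "\<lambda>s. (cmod (f s))\<^sup>2"] unit by simp
  moreover have "\<forall>i\<in>{1..card S}. f (h i) \<in> R"
    using f h by (auto dest: bij_betwE)
  ultimately have "\<exists>!i. i \<in> {1..card S} \<and> f (h i) \<noteq> 0"
    using R[unfolded unit_vectors_trivial_def, rule_format, of "card S" "\<lambda>i. f (h i)"] by blast
  then obtain i where i: "i \<in> {1..card S}" "f (h i) \<noteq> 0"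
    and uniq: "\<And>j. j \<in> {1..card S} \<Longrightarrow> f (h j) \<noteq> 0 \<Longrightarrow> j = i"
    by blast
  show ?thesis
  proof (intro ex1I conjI)
    show "h i \<in> S" using i h by (auto dest: bij_betwE)
    show "f (h i) \<noteq> 0" by (fact i)
    fix s assume s: "s \<in> S \<and> f s \<noteq> 0"
    then obtain j where "j \<in> {1..card S}" "s = h j"
      using h unfolding bij_betw_def by blast
    then show "s = h i" using uniq s by blast
  qed
qed

text \<open>Existence of a nonzero entry is automatic, as the squares sum to 1; only uniqueness
  remains. The premise is indexed by \<open>{..<n}\<close>, as matrices are.\<close>

lemma unit_vectors_trivialI:
  assumes "\<And>n (v :: nat \<Rightarrow> complex) i j. (\<And>k. k < n \<Longrightarrow> v k \<in> R) \<Longrightarrow> (\<Sum>k<n. (cmod (v k))\<^sup>2) = 1 \<Longrightarrow>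
    i < n \<Longrightarrow> j < n \<Longrightarrow> v i \<noteq> 0 \<Longrightarrow> v j \<noteq> 0 \<Longrightarrow> j = i"
  shows "unit_vectors_trivial R"
  unfolding unit_vectors_trivial_def
proof (intro allI impI, elim conjE)
  fix n :: nat and r :: "nat \<Rightarrow> complex"
  assume r: "\<forall>i\<in>{1..n}. r i \<in> R" and unit: "(\<Sum>i=1..n. (cmod (r i))\<^sup>2) = 1"
  have "\<exists>i\<in>{1..n}. r i \<noteq> 0"
  proof (rule ccontr)
    assume "\<not> ?thesis"
    then show False using unit by simp
  qed
  moreover have "j = i" if ij: "i \<in> {1..n}" "r i \<noteq> 0" "j \<in> {1..n}" "r j \<noteq> 0" for i j
  proof -
    have "(\<Sum>i<n. (cmod (r (Suc i)))\<^sup>2) = 1"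
      using unit by (simp add: sum.atLeast1_atMost_eq)
    \<comment> \<open>Entry \<open>r i\<close> sits at position \<open>i - 1\<close> of the shifted
      vector; truncated subtraction is harmless since \<open>i\<close> and \<open>j\<close> are
      positive.\<close>
    then have "j - 1 = i - 1"
      using ij r by (intro assms[of n "\<lambda>i. r (Suc i)"]) auto
    then show ?thesis using ij by auto
  qed
  ultimately show "\<exists>!i. i \<in> {1..n} \<and> r i \<noteq> 0" by blast
qed

text \<open>Transports the condition to a finite index set with a distinguished element
  \<open>a\<close>. Index 1 has to become \<open>a\<close>, so only the other elements are
  enumerated, by \<open>{2..card S}\<close>.\<close>

lemma projection_rows_trivialD:
  assumes R: "projection_rows_trivial R" and S: "finite S" "a \<in> S"
    and f: "\<And>s. s \<in> S \<Longrightarrow> f s \<in> R" and row: "f a = complex_of_real (\<Sum>s\<in>S. (cmod (f s))\<^sup>2)"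
    and b: "b \<in> S" "b \<noteq> a"
  shows "f b = 0"
proof -
  let ?n = "card S"
  have n: "?n \<ge> 1" using S by (auto simp: Suc_le_eq card_gt_0_iff)
  have "card {2..?n} = card (S - {a})" using S n by simp
  then obtain h where h: "bij_betw h {2..?n} (S - {a})"
    using S by (metis finite_Diff finite_atLeastAtMost finite_same_card_bij)
  define r where "r i = (if i = 1 then f a else f (h i))" for i
  have "(\<Sum>i=1..?n. (cmod (r i))\<^sup>2) = (cmod (f a))\<^sup>2 + (\<Sum>i=2..?n. (cmod (f (h i)))\<^sup>2)"
    using n by (simp add: sum.atLeast_Suc_atMost r_def numeral_2_eq_2)
  also have "(\<Sum>i=2..?n. (cmod (f (h i)))\<^sup>2) = (\<Sum>s\<in>S - {a}. (cmod (f s))\<^sup>2)"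
    using sum.reindex_bij_betw[OF h, of "\<lambda>s. (cmod (f s))\<^sup>2"] .
  also have "(cmod (f a))\<^sup>2 + \<dots> = (\<Sum>s\<in>S. (cmod (f s))\<^sup>2)"
    using S by (simp add: sum.remove)
  finally have "r 1 = complex_of_real (\<Sum>i=1..?n. (cmod (r i))\<^sup>2)"
    using row by (simp add: r_def)
  moreover have "\<forall>i\<in>{1..?n}. r i \<in> R"
  proof
    fix i assume "i \<in> {1..?n}"
    then have "i = 1 \<or> i \<in> {2..?n}" by auto
    then show "r i \<in> R" using f S bij_betwE[OF h] by (auto simp: r_def)
  qed
  ultimately have "\<forall>i\<in>{2..?n}. r i = 0"
    using R[unfolded projection_rows_trivial_def, rule_format, of ?n r] n by blast
  moreover obtain i where "i \<in> {2..?n}" "b = h i"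
    using h b unfolding bij_betw_def by blast
  ultimately show ?thesis by (auto simp: r_def)
qed

lemma unit_vectors_trivial_half_notin:
  assumes "unit_vectors_trivial R"
  shows "1 / 2 \<notin> R"
proof
  assume "1 / 2 \<in> R"
  then have ex1: "\<exists>!s::nat. s \<in> {..<4} \<and> (1 / 2 :: complex) \<noteq> 0"
    by (intro unit_vectors_trivial_ex1[OF assms]) (auto simp: power2_eq_square norm_divide)
  \<comment> \<open>The inequality in \<open>ex1\<close> does not mention the index, so unique
    existence identifies all indices below 4.\<close>
  have "a = b" if "a < 4" "b < 4" for a b :: nat using ex1 that by auto
  from this[of 0 1] show False by simp
qed

text \<open>If \<open>r\<close> is a row of a projection \<open>p\<close>, then \<open>1 - 2r\<close>, understood as the corresponding row
  of the unitary \<open>1 - 2p\<close>, is a unit vector.\<close>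

lemma unit_vectors_trivial_imp_projection_rows_trivial:
  assumes R: "conj_closed_subring R" and triv: "unit_vectors_trivial R"
  shows "projection_rows_trivial R"
  unfolding projection_rows_trivial_def
proof (intro allI impI ballI, elim conjE)
  note [intro] = conj_closed_subring_closed[OF R]
  fix n :: nat and r :: "nat \<Rightarrow> complex" and b
  assume n: "n \<ge> 1" and r: "\<forall>i\<in>{1..n}. r i \<in> R"
    and row: "r 1 = complex_of_real (\<Sum>i=1..n. (cmod (r i))\<^sup>2)" and b: "b \<in> {2..n}"
  \<comment> \<open>The hypothesis makes \<open>r 1\<close> the real number \<open>t\<close>, so the
    remaining entries have squared norm \<open>t - t\<^sup>2\<close>.\<close>
  define t where "t = (\<Sum>i=1..n. (cmod (r i))\<^sup>2)"
  \<comment> \<open>The first row of the unitary, up to signs off the diagonal. Doubling is written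
    as a sum to match the closure properties of \<open>R\<close>.\<close>
  define g where "g i = (if i = 1 then 1 - (r 1 + r 1) else r i + r i)" for i
  have r1: "r 1 = complex_of_real t" using row by (simp add: t_def)
  have split: "(\<Sum>i=1..n. h i) = h 1 + (\<Sum>i=2..n. h i)" for h :: "nat \<Rightarrow> real"
    using n by (simp add: sum.atLeast_Suc_atMost numeral_2_eq_2)
  have rest: "(\<Sum>i=2..n. (cmod (r i))\<^sup>2) = t - t\<^sup>2"
  proof -
    have "(cmod (r 1))\<^sup>2 = t\<^sup>2" by (simp only: r1 norm_of_real power2_abs)
    then show ?thesis using split[of "\<lambda>i. (cmod (r i))\<^sup>2", folded t_def] by linarith
  qed
  have "(\<Sum>i=1..n. (cmod (g i))\<^sup>2) = (cmod (g 1))\<^sup>2 + (\<Sum>i=2..n. (cmod (g i))\<^sup>2)"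
    by (rule split)
  also have "(\<Sum>i=2..n. (cmod (g i))\<^sup>2) = (\<Sum>i=2..n. 4 * (cmod (r i))\<^sup>2)"
    by (intro sum.cong) (auto simp: g_def norm_mult power_mult_distrib simp flip: mult_2)
  also have "\<dots> = 4 * (t - t\<^sup>2)"
    by (simp add: rest flip: sum_distrib_left)
  also have "cmod (g 1) = \<bar>1 - 2 * t\<bar>"
  proof -
    have "g 1 = complex_of_real (1 - 2 * t)" using r1 by (simp add: g_def)
    then show ?thesis by (simp only: norm_of_real)
  qed
  \<comment> \<open>This is the identity
    \<open>(1 - 2 * t)\<^sup>2 + 4 * (t - t\<^sup>2) = 1\<close>.\<close>
  finally have unit: "(\<Sum>i=1..n. (cmod (g i))\<^sup>2) = 1"
    by (simp add: power2_eq_square algebra_simps)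
  have "g i \<in> R" if i: "i \<in> {1..n}" for i
  proof -
    have "r 1 \<in> R" "r i \<in> R" using r n i by auto
    then have "1 - (r 1 + r 1) \<in> R" "r i + r i \<in> R"
      by (intro conj_closed_subring_closed[OF R]; simp)+
    then show ?thesis by (simp only: g_def split: if_split) simp
  qed
  then have ex1: "\<exists>!i. i \<in> {1..n} \<and> g i \<noteq> 0"
    using unit by (intro unit_vectors_trivial_ex1[OF triv]) auto
  show "r b = 0"
  proof (rule ccontr)
    assume "r b \<noteq> 0"
    then have "b \<in> {1..n} \<and> g b \<noteq> 0" "b \<noteq> 1" using b by (auto simp: g_def)
    moreover have "1 \<in> {1..n}" using n by simp
    \<comment> \<open>The entry \<open>g b\<close> already takes the single nonzero place, and
      \<open>g 1 = 0\<close> leaves only the excluded value 1/2 for \<open>r 1\<close>.\<close>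
    ultimately have "g 1 = 0" using ex1 by blast
    then have "r 1 = 1 / 2" by (simp add: g_def field_simps)
    moreover have "r 1 \<in> R" using r n by simp
    ultimately show False
      using unit_vectors_trivial_half_notin[OF triv] by metis
  qed
qed

lemma projection_rows_trivial_imp_unit_vectors_trivial:
  assumes R: "conj_closed_subring R" and triv: "projection_rows_trivial R"
  shows "unit_vectors_trivial R"
proof (rule unit_vectors_trivialI, rule ccontr)
  fix n i j and v :: "nat \<Rightarrow> complex"
  assume v: "\<And>k. k < n \<Longrightarrow> v k \<in> R" and unit: "(\<Sum>k<n. (cmod (v k))\<^sup>2) = 1"
    and ij: "i < n" "j < n" "v i \<noteq> 0" "v j \<noteq> 0" "j \<noteq> i"
  \<comment> \<open>Row \<open>i\<close> of the projection onto the line of \<open>v\<close> has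
    squared norm equal to its own diagonal entry, because \<open>v\<close> has norm 1.\<close>
  have "(\<Sum>k<n. (cmod (v i * cnj (v k)))\<^sup>2) = (cmod (v i))\<^sup>2"
    using unit by (simp add: norm_mult power_mult_distrib flip: sum_distrib_left)
  then have row: "v i * cnj (v i) = complex_of_real (\<Sum>k<n. (cmod (v i * cnj (v k)))\<^sup>2)"
    by (simp only: complex_norm_square[symmetric])
  have "v i * cnj (v j) = 0"
    by (rule projection_rows_trivialD[OF triv, of "{..<n}" i "\<lambda>k. v i * cnj (v k)" j, OF _ _ _ row])
      (use ij v in \<open>auto intro: conj_closed_subring_closed(5,6)[OF R]\<close>)
  then show False using ij by simp
qed

section \<open>Adjoints and unitary matrices\<close>

lemma dim_mat_adjoint [simp]: "dim_row (mat_adjoint A) = dim_col A" "dim_col (mat_adjoint A) = dim_row A"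
  by (auto simp: mat_adjoint_def)

lemma index_mat_adjoint [simp]:
  "i < dim_col A \<Longrightarrow> j < dim_row A \<Longrightarrow> mat_adjoint A $$ (i, j) = conjugate (A $$ (j, i))"
  by (simp add: mat_adjoint_def mat_of_rows_index)

lemma mat_adjoint_carrier [simp]: "A \<in> carrier_mat n m \<Longrightarrow> mat_adjoint A \<in> carrier_mat m n"
  unfolding carrier_mat_def by simp

lemma mat_adjoint_mat_adjoint [simp]: "mat_adjoint (mat_adjoint A) = A"
  by (rule eq_matI) auto

lemma index_mult_mat_sum:
  assumes "A \<in> carrier_mat n m" "B \<in> carrier_mat m l" "i < n" "j < l"
  shows "(A * B) $$ (i, j) = (\<Sum>k<m. A $$ (i, k) * B $$ (k, j))"
  using assms by (auto simp: scalar_prod_def lessThan_atLeast0 intro!: sum.cong)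

lemma mat_adjoint_mult:
  fixes A B :: "complex mat"
  assumes "A \<in> carrier_mat n m" "B \<in> carrier_mat m l"
  shows "mat_adjoint (A * B) = mat_adjoint B * mat_adjoint A"
proof (rule eq_matI)
  have ad: "mat_adjoint A \<in> carrier_mat m n" "mat_adjoint B \<in> carrier_mat l m"
    using assms by auto
  fix i j assume "i < dim_row (mat_adjoint B * mat_adjoint A)" "j < dim_col (mat_adjoint B * mat_adjoint A)"
  then have ij: "i < l" "j < n" using assms by auto
  show "mat_adjoint (A * B) $$ (i, j) = (mat_adjoint B * mat_adjoint A) $$ (i, j)"
    using assms ij by (simp add: index_mult_mat_sum[OF assms] index_mult_mat_sum[OF ad(2,1)]
        del: index_mult_mat(1)) (auto intro!: sum.cong)
qed (use assms in auto)

lemma elements_mat_subset_iff: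
  "A \<in> carrier_mat n m \<Longrightarrow> elements_mat A \<subseteq> R \<longleftrightarrow> (\<forall>i<n. \<forall>j<m. A $$ (i, j) \<in> R)"
  by (auto simp: elements_mat_def) (metis UN_subset_iff atLeastLessThan_iff image_subset_iff zero_le)

lemma elements_mat_adjoint:
  assumes R: "conj_closed_subring R" and A: "A \<in> carrier_mat n m" "elements_mat A \<subseteq> R"
  shows "elements_mat (mat_adjoint A) \<subseteq> R"
  using A conj_closed_subring_closed(6)[OF R]
  by (auto simp: elements_mat_subset_iff[OF A(1)] elements_mat_subset_iff[OF mat_adjoint_carrier[OF A(1)]])

text \<open>The inverse is the adjoint, whose entries stay in \<open>R\<close> by closure under
  conjugation.\<close>

lemma unitary_mat_in_GL_over:
  assumes R: "conj_closed_subring R"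
    and U: "U \<in> carrier_mat n n" "elements_mat U \<subseteq> R" "unitary_mat n U"
  shows "U \<in> GL_over R n"
  using U elements_mat_adjoint[OF R U(1,2)]
  unfolding GL_over_def unitary_mat_def by (auto intro!: bexI[of _ "mat_adjoint U"])

lemma unitary_mat_rows_orthonormal:
  assumes U: "U \<in> carrier_mat n n" "unitary_mat n U" and ij: "i < n" "j < n"
  shows "(\<Sum>k<n. U $$ (i, k) * cnj (U $$ (j, k))) = (if i = j then 1 else 0)"
proof -
  have "(U * mat_adjoint U) $$ (i, j) = (\<Sum>k<n. U $$ (i, k) * mat_adjoint U $$ (k, j))"
    using U ij by (intro index_mult_mat_sum) auto
  moreover have "U * mat_adjoint U = 1\<^sub>m n" using U by (simp add: unitary_mat_def)
  ultimately show ?thesis using U ij by simp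
qed

lemma unitary_mat_adjoint:
  "unitary_mat n U \<Longrightarrow> unitary_mat n (mat_adjoint U)"
  by (auto simp: unitary_mat_def)

lemma unitary_mat_row_norm:
  assumes "U \<in> carrier_mat n n" "unitary_mat n U" "i < n"
  shows "(\<Sum>k<n. (cmod (U $$ (i, k)))\<^sup>2) = 1"
proof -
  have "complex_of_real (\<Sum>k<n. (cmod (U $$ (i, k)))\<^sup>2) = 1"
    using unitary_mat_rows_orthonormal[OF assms(1,2,3,3)]
    by (simp add: complex_mult_cnj cmod_power2 flip: of_real_power)
  then show ?thesis by (metis of_real_eq_1_iff)
qed

lemma unitary_mat_row_nonzero:
  assumes "U \<in> carrier_mat n n" "unitary_mat n U" "i < n"
  shows "\<exists>k<n. U $$ (i, k) \<noteq> 0"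
proof (rule ccontr)
  assume "\<not> ?thesis"
  then show False using unitary_mat_row_norm[OF assms] by simp
qed

text \<open>The rows of a unitary matrix are unit vectors, and its columns are, up to conjugation,
  the rows of its adjoint. The fact \<open>row\<close> is therefore stated for an arbitrary
  unitary.\<close>

lemma unit_vectors_trivial_imp_unitaries_monomial:
  assumes R: "conj_closed_subring R" and triv: "unit_vectors_trivial R"
  shows "unitaries_monomial R"
  unfolding unitaries_monomial_def
proof (intro allI impI ballI)
  fix n U assume "U \<in> GL_over R n" and unit: "unitary_mat n U"
  then have U: "U \<in> carrier_mat n n" "elements_mat U \<subseteq> R" by (auto simp: GL_over_def)
  have row: "\<exists>!j. j < n \<and> U $$ (i, j) \<noteq> 0"
    if "U \<in> carrier_mat n n" "elements_mat U \<subseteq> R" "unitary_mat n U" "i < n" for U i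
    using unit_vectors_trivial_ex1[OF triv, of "{..<n}" "\<lambda>j. U $$ (i, j)"]
      unitary_mat_row_norm[OF that(1,3,4)] that by (simp add: elements_mat_subset_iff[OF that(1)])
  note el = elements_mat_adjoint[OF R U]
  have "\<exists>!i. i < n \<and> U $$ (i, j) \<noteq> 0" if "j < n" for j
  proof -
    have "\<exists>!i. i < n \<and> mat_adjoint U $$ (j, i) \<noteq> 0"
      using U by (intro row el unitary_mat_adjoint[OF unit] that) auto
    moreover have "i < n \<Longrightarrow> mat_adjoint U $$ (j, i) = cnj (U $$ (i, j))" for i
      using U that by simp
    ultimately show ?thesis by (metis complex_cnj_zero_iff)
  qed
  then show "monomial_mat n U"
    using row[OF U unit] by (simp add: monomial_mat_def)
qed

section \<open>Householder reflections\<close>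

text \<open>The reflection \<open>1 - 2 v v\<^sup>*\<close>, again with the doubling written as a
  sum.\<close>

definition householder :: "nat \<Rightarrow> (nat \<Rightarrow> complex) \<Rightarrow> complex mat" where
  "householder n v = mat n n (\<lambda>(i, j). (if i = j then 1 else 0) - (v i * cnj (v j) + v i * cnj (v j)))"

text \<open>The reflection is self-adjoint, so both unitarity equations amount to its square being
  the identity.\<close>

lemma householder_unitary:
  assumes R: "conj_closed_subring R" and v: "\<And>i. i < n \<Longrightarrow> v i \<in> R"
    and unit: "(\<Sum>i<n. (cmod (v i))\<^sup>2) = 1"
  shows "householder n v \<in> GL_over R n" "unitary_mat n (householder n v)"
proof -
  let ?H = "householder n v"
  note cl = conj_closed_subring_closed[OF R]
  have H: "?H \<in> carrier_mat n n" by (simp add: householder_def)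
  have el: "elements_mat ?H \<subseteq> R"
    unfolding elements_mat_subset_iff[OF H]
  proof (intro allI impI)
    fix i j assume ij: "i < n" "j < n"
    have "?H $$ (i, j) = (if i = j then 1 else 0) - (v i * cnj (v j) + v i * cnj (v j))"
      using ij by (simp add: householder_def)
    moreover have "\<dots> \<in> R"
      using v ij by (intro cl) (auto simp: cl)
    ultimately show "?H $$ (i, j) \<in> R" by simp
  qed
  have unit': "(\<Sum>k<n. v k * cnj (v k)) = 1"
    using arg_cong[OF unit, of complex_of_real] by (simp only: of_real_sum complex_norm_square of_real_1)
  have adj: "mat_adjoint ?H = ?H"
    by (rule eq_matI) (auto simp: householder_def)
  have "?H * ?H = 1\<^sub>m n"
  proof (rule eq_matI)
    fix i j assume "i < dim_row (1\<^sub>m n)" "j < dim_col (1\<^sub>m n)"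
    then have ij: "i < n" "j < n" by auto
    let ?d = "\<lambda>i j. if i = j then 1 else (0::complex)"
    have "(?H * ?H) $$ (i, j) =
        (\<Sum>k<n. (?d i k - 2 * v i * cnj (v k)) * (?d k j - 2 * v k * cnj (v j)))"
      using ij by (subst index_mult_mat_sum[OF H H]) (auto simp: householder_def mult.assoc intro!: sum.cong)
    \<comment> \<open>With \<open>P = v v\<^sup>*\<close> this expands
      \<open>(1 - 2 P) (1 - 2 P)\<close>; the last sum is 1, so the \<open>P\<close> terms cancel as
      -2 - 2 + 4.\<close>
    also have "\<dots> = (\<Sum>k<n. ?d i k * ?d k j) - (\<Sum>k<n. ?d i k * (2 * v k * cnj (v j)))
        - (\<Sum>k<n. 2 * v i * cnj (v k) * ?d k j) + 4 * v i * cnj (v j) * (\<Sum>k<n. v k * cnj (v k))"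
      by (simp add: algebra_simps sum.distrib sum_subtractf sum_distrib_left)
    also have "\<dots> = ?d i j"
      using ij by (simp add: unit' if_distrib[of "\<lambda>x. _ * x"] if_distrib[of "\<lambda>x. x * _"] cong: if_cong)
    finally show "(?H * ?H) $$ (i, j) = 1\<^sub>m n $$ (i, j)" using ij by simp
  qed (auto simp: householder_def)
  then show "unitary_mat n ?H" by (simp add: unitary_mat_def adj)
  then show "?H \<in> GL_over R n" using unitary_mat_in_GL_over[OF R H el] by blast
qed

text \<open>Two nonzero entries of \<open>v\<close> make an off-diagonal entry of the reflection
  nonzero. The diagonal entry of that row must then vanish, which puts 1/2 into
  \<open>R\<close>.\<close>

lemma unitaries_monomial_imp_unit_vectors_trivial:
  assumes R: "conj_closed_subring R" and triv: "unitaries_monomial R"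
  shows "unit_vectors_trivial R"
proof -
  note cl = conj_closed_subring_closed[OF R]
  have row: "j = k" if v: "\<And>i. i < n \<Longrightarrow> v i \<in> R" "(\<Sum>i<n. (cmod (v i))\<^sup>2) = 1" and "i < n" "j < n" "k < n"
      "householder n v $$ (i, j) \<noteq> 0" "householder n v $$ (i, k) \<noteq> 0"
    for n i j k and v :: "nat \<Rightarrow> complex"
  proof -
    have "monomial_mat n (householder n v)"
      using triv householder_unitary[OF R v] that(3) unfolding unitaries_monomial_def by simp
    then show ?thesis using that by (auto simp: monomial_mat_def)
  qed
  have half: "1 / 2 \<notin> R"
  proof
    assume "1 / 2 \<in> R"
    \<comment> \<open>The reflection in the vector of four halves has all entries 1/2 or -1/2, so
      its row 0 is nonzero in columns 0 and 1.\<close>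
    then have "(0::nat) = 1"
      by (intro row[of 4 "\<lambda>_. 1 / 2" 0]) (auto simp: householder_def power2_eq_square norm_divide)
    then show False by simp
  qed
  have triv0: "j = i" if v: "\<And>i. i < n \<Longrightarrow> v i \<in> R" "(\<Sum>i<n. (cmod (v i))\<^sup>2) = 1"
      and ij: "i < n" "j < n" "v i \<noteq> 0" "v j \<noteq> 0" for n i j and v :: "nat \<Rightarrow> complex"
  proof (rule ccontr)
    assume "j \<noteq> i"
    then have "householder n v $$ (i, j) \<noteq> 0" using ij by (simp add: householder_def)
    then have "householder n v $$ (i, i) = 0"
      using row[OF v ij(1,2,1)] \<open>j \<noteq> i\<close> by blast
    then have "v i * cnj (v i) = 1 / 2"
      using ij by (simp add: householder_def field_simps)
    then show False using half cl(5,6) v(1) ij(1) by metis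
  qed
  show ?thesis by (rule unit_vectors_trivialI) (rule triv0)
qed

section \<open>Locally constant maps\<close>

lemma openin_finite_Ball:
  assumes "finite F" "\<And>a. a \<in> F \<Longrightarrow> openin X {y \<in> topspace X. Q a y}"
  shows "openin X {y \<in> topspace X. \<forall>a\<in>F. Q a y}"
  using assms
proof (induction F)
  case (insert a F)
  then have "openin X ({y \<in> topspace X. Q a y} \<inter> {y \<in> topspace X. \<forall>a\<in>F. Q a y})"
    by (intro openin_Int) auto
  moreover have "{y \<in> topspace X. Q a y} \<inter> {y \<in> topspace X. \<forall>a\<in>F. Q a y} =
      {y \<in> topspace X. \<forall>a\<in>insert a F. Q a y}" by auto
  ultimately show ?case by simp
qed auto

lemma locally_constant_map_openin:
  assumes "locally_constant_map X f"
  shows "openin X {x \<in> topspace X. P (f x)}"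
proof (subst openin_subopen, intro ballI)
  fix x assume x: "x \<in> {x \<in> topspace X. P (f x)}"
  then have "x \<in> topspace X" by simp
  then obtain U where U: "openin X U" "x \<in> U" and const: "\<And>y. y \<in> U \<Longrightarrow> f y = f x"
    using assms unfolding locally_constant_map_def by metis
  have "y \<in> {x \<in> topspace X. P (f x)}" if "y \<in> U" for y
    using const[OF that] x subsetD[OF openin_subset[OF U(1)] that] by simp
  then show "\<exists>T. openin X T \<and> x \<in> T \<and> T \<subseteq> {x \<in> topspace X. P (f x)}"
    using U by blast
qed

text \<open>Since \<open>P\<close> is arbitrary, the complement is again a set of the same kind,
  hence open.\<close>

lemma locally_constant_map_closedin:
  assumes "locally_constant_map X f"
  shows "closedin X {x \<in> topspace X. P (f x)}"
proof -
  have "topspace X - {x \<in> topspace X. P (f x)} = {x \<in> topspace X. \<not> P (f x)}" by auto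
  then show ?thesis
    using locally_constant_map_openin[OF assms, of "\<lambda>y. \<not> P y"] by (simp add: closedin_def)
qed

lemma locally_constant_map_binop:
  assumes "locally_constant_map X f" "locally_constant_map X g"
  shows "locally_constant_map X (\<lambda>x. F (f x) (g x))"
  unfolding locally_constant_map_def
proof
  fix x assume "x \<in> topspace X"
  then obtain U V where "openin X U" "x \<in> U" "\<forall>y\<in>U. f y = f x" "openin X V" "x \<in> V" "\<forall>y\<in>V. g y = g x"
    using assms unfolding locally_constant_map_def by meson
  note UV = this
  show "\<exists>U. openin X U \<and> x \<in> U \<and> (\<forall>y\<in>U. F (f y) (g y) = F (f x) (g x))"
  proof (intro exI[of _ "U \<inter> V"] conjI ballI)
    show "openin X (U \<inter> V)" "x \<in> U \<inter> V" using UV(1,2,4,5) by auto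
    fix y assume "y \<in> U \<inter> V"
    then have "f y = f x" "g y = g x" using UV(3,6) by blast+
    then show "F (f y) (g y) = F (f x) (g x)" by simp
  qed
qed

lemma locally_constant_map_compose:
  assumes "continuous_map X Y h" "locally_constant_map Y f"
  shows "locally_constant_map X (\<lambda>x. f (h x))"
  unfolding locally_constant_map_def
proof
  fix x assume x: "x \<in> topspace X"
  have "openin X {y \<in> topspace X. h y \<in> {z \<in> topspace Y. f z = f (h x)}}"
    by (rule openin_continuous_map_preimage[OF assms(1) locally_constant_map_openin[OF assms(2)]])
  moreover have "h x \<in> topspace Y"
    using x continuous_map_funspace[OF assms(1)] by auto
  ultimately show "\<exists>U. openin X U \<and> x \<in> U \<and> (\<forall>y\<in>U. f (h y) = f (h x))"
    using x by (intro exI[of _ "{y \<in> topspace X. h y \<in> {z \<in> topspace Y. f z = f (h x)}}"]) auto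
qed

text \<open>Finitely many open sets on which \<open>f\<close> is constant cover \<open>K\<close>,
  and each contributes at most one value.\<close>

lemma locally_constant_map_finite_image:
  assumes lc: "locally_constant_map X f" and K: "compactin X K"
  shows "finite (f ` K)"
proof -
  let ?\<U> = "{U. openin X U \<and> (\<exists>c. \<forall>y\<in>U. f y = c)}"
  have "K \<subseteq> \<Union>?\<U>"
  proof
    fix x assume "x \<in> K"
    then obtain U where "openin X U" "x \<in> U" "\<forall>y\<in>U. f y = f x"
      using lc compactin_subset_topspace[OF K] unfolding locally_constant_map_def by (meson subsetD)
    then show "x \<in> \<Union>?\<U>" by blast
  qed
  then obtain \<F> where \<F>: "finite \<F>" "\<F> \<subseteq> ?\<U>" "K \<subseteq> \<Union>\<F>"
    using compactinD[OF K, of ?\<U>] by auto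
  have "finite (f ` U)" if "U \<in> \<F>" for U
  proof -
    have "\<exists>c. \<forall>y\<in>U. f y = c" using \<F>(2) that by auto
    then obtain c where "\<forall>y\<in>U. f y = c" ..
    then have "f ` U \<subseteq> {c}" by auto
    then show ?thesis by (rule finite_subset) auto
  qed
  then have "finite (\<Union>U\<in>\<F>. f ` U)" using \<F> by blast
  moreover have "f ` K \<subseteq> (\<Union>U\<in>\<F>. f ` U)" using image_mono[OF \<F>(3), of f] by (simp only: image_Union)
  ultimately show ?thesis by (rule finite_subset[rotated])
qed

text \<open>Separate the points pairwise and intersect; finiteness keeps the intersections
  open.\<close>

lemma Hausdorff_space_finite_separation:
  assumes X: "Hausdorff_space X" and F: "finite F" "F \<subseteq> topspace X"
  obtains V where "\<And>a. a \<in> F \<Longrightarrow> openin X (V a)" "\<And>a. a \<in> F \<Longrightarrow> a \<in> V a"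
    "\<And>a b. a \<in> F \<Longrightarrow> b \<in> F \<Longrightarrow> a \<noteq> b \<Longrightarrow> V a \<inter> V b = {}"
proof -
  have "\<exists>p. openin X (fst p) \<and> openin X (snd p) \<and> a \<in> fst p \<and> b \<in> snd p \<and> fst p \<inter> snd p = {}"
    if "a \<in> F" "b \<in> F" "a \<noteq> b" for a b
    using X that subsetD[OF F(2) that(1)] subsetD[OF F(2) that(2)]
    unfolding Hausdorff_space_def disjnt_def by (metis fst_conv snd_conv)
  then obtain p where p: "\<And>a b. a \<in> F \<Longrightarrow> b \<in> F \<Longrightarrow> a \<noteq> b \<Longrightarrow> openin X (fst (p a b)) \<and>
      openin X (snd (p a b)) \<and> a \<in> fst (p a b) \<and> b \<in> snd (p a b) \<and> fst (p a b) \<inter> snd (p a b) = {}"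
    by metis
  define P Q where "P a b = fst (p a b)" and "Q a b = snd (p a b)" for a b
  have PQ: "openin X (P a b) \<and> openin X (Q a b) \<and> a \<in> P a b \<and> b \<in> Q a b \<and> P a b \<inter> Q a b = {}"
    if "a \<in> F" "b \<in> F" "a \<noteq> b" for a b
    using p[OF that] by (simp add: P_def Q_def)
  \<comment> \<open>The pair chosen for \<open>(a, b)\<close> need not be the swap of the pair for
    \<open>(b, a)\<close>, so \<open>V a\<close> is put inside both neighbourhoods of
    \<open>a\<close>. Then \<open>V a\<close> lies in \<open>P a b\<close> and \<open>V b\<close> in
    \<open>Q a b\<close>.\<close>
  define V where "V a = {y \<in> topspace X. \<forall>b\<in>F - {a}. y \<in> P a b \<and> y \<in> Q b a}" for a
  show ?thesis
  proof
    show "openin X (V a)" if "a \<in> F" for a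
      unfolding V_def
    proof (rule openin_finite_Ball)
      fix b assume "b \<in> F - {a}"
      then have "openin X (P a b \<inter> Q b a)" using PQ that by auto
      moreover from this have "{y \<in> topspace X. y \<in> P a b \<and> y \<in> Q b a} = P a b \<inter> Q b a"
        using openin_subset[of X "P a b \<inter> Q b a"] by blast
      ultimately show "openin X {y \<in> topspace X. y \<in> P a b \<and> y \<in> Q b a}" by simp
    qed (use F in auto)
    show "a \<in> V a" if "a \<in> F" for a
      using F(2) PQ[OF that] PQ[OF _ that] that unfolding V_def by blast
    show "V a \<inter> V b = {}" if "a \<in> F" "b \<in> F" "a \<noteq> b" for a b
      using PQ[OF that] that unfolding V_def by blast
  qed
qed

section \<open>Hausdorff ample groupoids and their algebras\<close>

text \<open>The set where a locally constant function is nonzero is already closed, so taking the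
  closure changes nothing.\<close>

lemma groupoid_algebra_iff:
  "f \<in> groupoid_algebra R G \<longleftrightarrow>
     (\<forall>x\<in>arrows G. f x \<in> R) \<and> (\<forall>x. x \<notin> arrows G \<longrightarrow> f x = 0) \<and>
     locally_constant_map (gtop G) f \<and> compactin (gtop G) {x \<in> arrows G. f x \<noteq> 0}"
proof -
  have "gtop G closure_of {x \<in> arrows G. f x \<noteq> 0} = {x \<in> arrows G. f x \<noteq> 0}"
    if "locally_constant_map (gtop G) f"
    using locally_constant_map_closedin[OF that, of "\<lambda>y. y \<noteq> 0"]
    by (simp add: closure_of_closedin arrows_def)
  then show ?thesis by (auto simp: groupoid_algebra_def)
qed

text \<open>Any compact set containing the support will do, because the support is closed in
  it.\<close>

lemma groupoid_algebraI:
  assumes "\<And>x. x \<in> arrows G \<Longrightarrow> f x \<in> R" "\<And>x. x \<notin> arrows G \<Longrightarrow> f x = 0"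
    and lc: "locally_constant_map (gtop G) f"
    and K: "compactin (gtop G) K" "\<And>x. x \<in> arrows G \<Longrightarrow> f x \<noteq> 0 \<Longrightarrow> x \<in> K"
  shows "f \<in> groupoid_algebra R G"
proof -
  have "{x \<in> arrows G. f x \<noteq> 0} \<subseteq> K" using K(2) by blast
  moreover have "closedin (gtop G) {x \<in> arrows G. f x \<noteq> 0}"
    using locally_constant_map_closedin[OF lc, of "\<lambda>y. y \<noteq> 0"] by (simp add: arrows_def)
  ultimately have "compactin (gtop G) {x \<in> arrows G. f x \<noteq> 0}"
    by (rule closed_compactin[OF K(1)])
  then show ?thesis
    using assms(1,2) lc by (simp add: groupoid_algebra_iff)
qed

context
  fixes R :: "complex set"
  assumes R: "conj_closed_subring R"
begin

lemma groupoid_algebra_zero: "(\<lambda>x. 0) \<in> groupoid_algebra R G"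
proof -
  have "locally_constant_map (gtop G) (\<lambda>x. 0 :: complex)"
    unfolding locally_constant_map_def using openin_topspace by blast
  then show ?thesis
    by (simp add: groupoid_algebra_iff conj_closed_subring_closed(2)[OF R])
qed

lemma groupoid_algebra_add:
  assumes f: "f \<in> groupoid_algebra R G" and g: "g \<in> groupoid_algebra R G"
  shows "(\<lambda>x. f x + g x) \<in> groupoid_algebra R G"
proof -
  have lc: "locally_constant_map (gtop G) f" "locally_constant_map (gtop G) g"
    and K: "compactin (gtop G) {x \<in> arrows G. f x \<noteq> 0}" "compactin (gtop G) {x \<in> arrows G. g x \<noteq> 0}"
    and fR: "\<And>x. x \<in> arrows G \<Longrightarrow> f x \<in> R" "\<And>x. x \<in> arrows G \<Longrightarrow> g x \<in> R"
    and f0: "\<And>x. x \<notin> arrows G \<Longrightarrow> f x = 0" "\<And>x. x \<notin> arrows G \<Longrightarrow> g x = 0"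
    using f g unfolding groupoid_algebra_iff by auto
  show ?thesis
  proof (rule groupoid_algebraI[OF _ _ _ compactin_Un[OF K]])
    show "locally_constant_map (gtop G) (\<lambda>x. f x + g x)" by (rule locally_constant_map_binop[OF lc])
    show "f x + g x \<in> R" if "x \<in> arrows G" for x
      by (rule conj_closed_subring_closed(4)[OF R fR(1)[OF that] fR(2)[OF that]])
    show "f x + g x = 0" if "x \<notin> arrows G" for x
      by (simp only: f0[OF that] add_0)
  qed auto
qed

lemma groupoid_algebra_scale:
  assumes "c \<in> R" and f: "f \<in> groupoid_algebra R G"
  shows "(\<lambda>x. c * f x) \<in> groupoid_algebra R G"
proof -
  have lc: "locally_constant_map (gtop G) f"
    and K: "compactin (gtop G) {x \<in> arrows G. f x \<noteq> 0}"
    and fR: "\<And>x. x \<in> arrows G \<Longrightarrow> f x \<in> R" and f0: "\<And>x. x \<notin> arrows G \<Longrightarrow> f x = 0"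
    using f unfolding groupoid_algebra_iff by auto
  show ?thesis
  proof (rule groupoid_algebraI[OF _ _ _ K])
    show "locally_constant_map (gtop G) (\<lambda>x. c * f x)"
      by (rule locally_constant_map_binop[OF lc lc, of "\<lambda>x y. c * x"])
    show "c * f x \<in> R" if "x \<in> arrows G" for x
      by (rule conj_closed_subring_closed(5)[OF R \<open>c \<in> R\<close> fR[OF that]])
    show "c * f x = 0" if "x \<notin> arrows G" for x
      by (simp only: f0[OF that] mult_zero_right)
  qed auto
qed

text \<open>The coefficients themselves index the sum: this is the shape in which a function is
  decomposed into its level sets, one for each value.\<close>

lemma groupoid_algebra_sum:
  assumes "\<And>c. c \<in> C \<Longrightarrow> c \<in> R" "\<And>c. c \<in> C \<Longrightarrow> p c \<in> groupoid_algebra R G"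
  shows "(\<lambda>x. \<Sum>c\<in>C. c * p c x) \<in> groupoid_algebra R G"
  using assms
proof (induction C rule: infinite_finite_induct)
  case (insert a F)
  then show ?case
    using groupoid_algebra_add[OF groupoid_algebra_scale[of a "p a"]] by fastforce
qed (auto simp: groupoid_algebra_zero)

lemma star_hom_sum:
  assumes \<phi>: "star_hom R G H \<phi>" and "finite C"
    and "\<And>c. c \<in> C \<Longrightarrow> c \<in> R" "\<And>c. c \<in> C \<Longrightarrow> p c \<in> groupoid_algebra R G"
  shows "\<phi> (\<lambda>x. \<Sum>c\<in>C. c * p c x) = (\<lambda>y. \<Sum>c\<in>C. c * \<phi> (p c) y)"
proof -
  have add: "\<phi> (\<lambda>x. f x + g x) = (\<lambda>y. \<phi> f y + \<phi> g y)"
    if "f \<in> groupoid_algebra R G" "g \<in> groupoid_algebra R G" for f g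
    using \<phi> that by (simp add: star_hom_def)
  have scale: "\<phi> (\<lambda>x. c * f x) = (\<lambda>y. c * \<phi> f y)"
    if "c \<in> R" "f \<in> groupoid_algebra R G" for c f
    using \<phi> that by (simp add: star_hom_def)
  show ?thesis
    using assms(2-)
  proof (induction C)
    case empty
    \<comment> \<open>Preservation of zero is scaling by the scalar \<open>0\<close>.\<close>
    show ?case
      using scale[OF conj_closed_subring_closed(2)[OF R] groupoid_algebra_zero] by simp
  next
    case (insert a C)
    have "\<phi> (\<lambda>x. \<Sum>c\<in>insert a C. c * p c x) = \<phi> (\<lambda>x. a * p a x + (\<Sum>c\<in>C. c * p c x))"
      using insert.hyps by simp
    also have "\<dots> = (\<lambda>y. \<phi> (\<lambda>x. a * p a x) y + \<phi> (\<lambda>x. \<Sum>c\<in>C. c * p c x) y)"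
      using insert.prems by (intro add groupoid_algebra_scale groupoid_algebra_sum) auto
    also have "\<phi> (\<lambda>x. a * p a x) = (\<lambda>y. a * \<phi> (p a) y)"
      using insert.prems by (intro scale) auto
    also have "\<phi> (\<lambda>x. \<Sum>c\<in>C. c * p c x) = (\<lambda>y. \<Sum>c\<in>C. c * \<phi> (p c) y)"
      using insert.prems by (intro insert.IH) auto
    finally show ?case using insert.hyps by simp
  qed
qed

end

section \<open>Groupoid laws and continuity of the structure maps\<close>

locale hausdorff_ample =
  fixes G :: "'g groupoid"
  assumes hausdorff_ample: "hausdorff_ample_groupoid G"
begin

lemma Hausdorff: "Hausdorff_space (gtop G)"
  and groupoid: "is_groupoid G"
  and mult_continuous: "continuous_map (subtopology (prod_topology (gtop G) (gtop G)) (composable G)) (gtop G)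
       (\<lambda>(a, b). gmult G a b)"
  and ginv_continuous: "continuous_map (gtop G) (gtop G) (ginv G)"
  and ran_local_homeomorphism: "local_homeomorphism (gtop G) (unit_top G) (gran G)"
  using hausdorff_ample
  by (auto simp: hausdorff_ample_groupoid_def ample_groupoid_def topological_groupoid_def)

lemma arrows_closed:
  assumes "a \<in> arrows G"
  shows "gdom G a \<in> arrows G" "gran G a \<in> arrows G" "ginv G a \<in> arrows G"
    "gdom G (gdom G a) = gdom G a" "gran G (gdom G a) = gdom G a"
    "gdom G (gran G a) = gran G a" "gran G (gran G a) = gran G a"
    "gmult G (gran G a) a = a" "gmult G a (gdom G a) = a"
    "gdom G (ginv G a) = gran G a" "gran G (ginv G a) = gdom G a"
    "gmult G a (ginv G a) = gran G a" "gmult G (ginv G a) a = gdom G a"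
  using groupoid assms unfolding is_groupoid_def by blast+

lemma mult_closed:
  assumes "a \<in> arrows G" "b \<in> arrows G" "gdom G a = gran G b"
  shows "gmult G a b \<in> arrows G" "gdom G (gmult G a b) = gdom G b" "gran G (gmult G a b) = gran G a"
proof -
  have "(a, b) \<in> composable G" using assms by (simp add: composable_def)
  then show "gmult G a b \<in> arrows G" "gdom G (gmult G a b) = gdom G b" "gran G (gmult G a b) = gran G a"
    using groupoid unfolding is_groupoid_def by blast+
qed

lemma mult_assoc:
  assumes "a \<in> arrows G" "b \<in> arrows G" "c \<in> arrows G" "gdom G a = gran G b" "gdom G b = gran G c"
  shows "gmult G (gmult G a b) c = gmult G a (gmult G b c)"
proof -
  have "(a, b) \<in> composable G" "(b, c) \<in> composable G" using assms by (auto simp: composable_def)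
  then show ?thesis using groupoid unfolding is_groupoid_def by blast
qed

lemma unit_spaceD:
  assumes "u \<in> unit_space G"
  shows "u \<in> arrows G" "gdom G u = u" "gran G u = u"
  using assms arrows_closed by (auto simp: unit_space_def)

lemma ran_in_unit_space: "a \<in> arrows G \<Longrightarrow> gran G a \<in> unit_space G"
  unfolding unit_space_def by (metis arrows_closed(2,6) image_eqI)

text \<open>The inverse of \<open>u\<close> has domain \<open>u\<close>, so it is unchanged by
  multiplication with \<open>u\<close> on the right; that product is also the domain of
  \<open>u\<close>, which is \<open>u\<close>.\<close>

lemma ginv_unit:
  assumes "u \<in> unit_space G"
  shows "ginv G u = u"
  using arrows_closed[of u] arrows_closed(9)[of "ginv G u"] unit_spaceD[OF assms] by metis

lemma ginv_ginv:
  assumes a: "a \<in> arrows G"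
  shows "ginv G (ginv G a) = a"
proof -
  let ?b = "ginv G a"
  let ?c = "ginv G ?b"
  have b: "?b \<in> arrows G" and c: "?c \<in> arrows G" using a arrows_closed by auto
  have "?c = gmult G ?c (gmult G ?b a)"
    using arrows_closed[OF a] arrows_closed[OF b] arrows_closed(9)[OF c] by metis
  also have "\<dots> = gmult G (gmult G ?c ?b) a"
    using arrows_closed[OF a] arrows_closed[OF b] a b c by (intro mult_assoc[symmetric]) auto
  also have "\<dots> = a"
    using arrows_closed[OF a] arrows_closed[OF b] by metis
  finally show ?thesis .
qed

lemma mult_ginv_cancel:
  assumes "a \<in> arrows G" "c \<in> arrows G" "gran G a = gran G c"
  shows "gmult G a (gmult G (ginv G a) c) = c"
proof -
  have "gmult G a (gmult G (ginv G a) c) = gmult G (gmult G a (ginv G a)) c"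
    using assms arrows_closed[OF assms(1)] by (intro mult_assoc[symmetric]) auto
  then show ?thesis
    using assms arrows_closed[OF assms(1)] arrows_closed(8)[OF assms(2)] by simp
qed

lemma arrows_topspace: "topspace (gtop G) = arrows G"
  by (simp add: arrows_def)

text \<open>The range of \<open>a\<close> is the product of \<open>a\<close> with its
  inverse.\<close>

lemma ran_continuous: "continuous_map (gtop G) (gtop G) (gran G)"
proof -
  have "continuous_map (gtop G) (subtopology (prod_topology (gtop G) (gtop G)) (composable G))
      (\<lambda>a. (a, ginv G a))"
    using ginv_continuous arrows_closed
    by (intro continuous_map_into_subtopology continuous_map_pairedI)
      (auto simp: arrows_topspace composable_def)
  from continuous_map_compose[OF this mult_continuous]
  show ?thesis
    by (rule continuous_map_eq) (auto simp: arrows_topspace arrows_closed)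
qed

lemma dom_continuous: "continuous_map (gtop G) (gtop G) (gdom G)"
  by (rule continuous_map_eq[OF continuous_map_compose[OF ginv_continuous ran_continuous]])
    (auto simp: arrows_topspace arrows_closed)

lemma ran_continuous_unit_top: "continuous_map (gtop G) (unit_top G) (gran G)"
  unfolding unit_top_def
  by (rule continuous_map_into_subtopology[OF ran_continuous])
    (auto simp: arrows_topspace ran_in_unit_space)

section \<open>Local sections of the range map and closure of the algebra\<close>

text \<open>The section \<open>s\<close> inverts the range map on \<open>U\<close>. It is presented
  as the continuous map \<open>y \<mapsto> s (gran G y)\<close> on all arrows whose range lies below
  \<open>U\<close>, which is how a factor of a convolution varies with its argument.\<close>

lemma ran_local_section:
  assumes "openin (gtop G) V" "x \<in> V"
  obtains U s where "openin (gtop G) U" "x \<in> U" "U \<subseteq> V" "inj_on (gran G) U"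
    "openin (gtop G) {y \<in> arrows G. gran G y \<in> gran G ` U}"
    "continuous_map (subtopology (gtop G) {y \<in> arrows G. gran G y \<in> gran G ` U}) (gtop G) (\<lambda>y. s (gran G y))"
    "\<And>a. a \<in> U \<Longrightarrow> s (gran G a) = a"
proof -
  let ?X = "gtop G" and ?Y = "unit_top G" and ?r = "gran G"
  have "x \<in> topspace ?X" using assms openin_subset by blast
  then obtain U0 where U0: "openin ?X U0" "x \<in> U0" "openin ?Y (?r ` U0)"
    and homeo: "homeomorphic_map (subtopology ?X U0) (subtopology ?Y (?r ` U0)) ?r"
    using ran_local_homeomorphism unfolding local_homeomorphism_def by meson
  obtain s where s: "homeomorphic_maps (subtopology ?X U0) (subtopology ?Y (?r ` U0)) ?r s"
    using homeo homeomorphic_map_maps by blast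
  have sr: "s (?r a) = a" if "a \<in> U0" for a
    using s that openin_subset[OF U0(1)] by (auto simp: homeomorphic_maps_def)
  let ?U = "U0 \<inter> V"
  \<comment> \<open>Shrinking into \<open>V\<close> keeps the image open, because a homeomorphism is
    an open map and the image of \<open>U0\<close> is open among the units.\<close>
  have "openin (subtopology ?X U0) ?U"
    using assms U0 by (simp add: openin_open_subtopology openin_Int)
  then have "openin (subtopology ?Y (?r ` U0)) (?r ` ?U)"
    using homeomorphic_imp_open_map[OF homeo] unfolding open_map_def by blast
  then have rU: "openin ?Y (?r ` ?U)"
    using U0(3) openin_trans_full by blast
  let ?W = "{y \<in> arrows G. ?r y \<in> ?r ` ?U}"
  show thesis
  proof
    show "openin ?X ?U" using assms U0 by auto
    show "x \<in> ?U" "?U \<subseteq> V" using assms U0 by auto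
    show "inj_on ?r ?U" by (rule inj_on_inverseI[of _ s]) (use sr in auto)
    show "openin ?X ?W"
      using openin_continuous_map_preimage[OF ran_continuous_unit_top rU] by (simp add: arrows_topspace)
    have "continuous_map (subtopology ?X ?W) (subtopology ?Y (?r ` U0)) ?r"
      by (intro continuous_map_into_subtopology continuous_map_from_subtopology ran_continuous_unit_top) auto
    moreover have "continuous_map (subtopology ?Y (?r ` U0)) ?X s"
      using s by (auto simp: homeomorphic_maps_def continuous_map_in_subtopology)
    ultimately show "continuous_map (subtopology ?X ?W) ?X (\<lambda>y. s (?r y))"
      using continuous_map_compose by (fastforce simp: o_def)
    show "s (?r a) = a" if "a \<in> ?U" for a using sr that by auto
  qed
qed

text \<open>Finitely many open sets on which the range map is injective cover the support, and each
  meets the fibre in at most one arrow.\<close>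

lemma finite_fibre_support:
  assumes f: "f \<in> groupoid_algebra R G"
  shows "finite {a \<in> arrows G. gran G a = x \<and> f a \<noteq> 0}"
proof -
  let ?S = "{a \<in> arrows G. f a \<noteq> 0}"
  let ?\<U> = "{U. openin (gtop G) U \<and> inj_on (gran G) U}"
  have S: "compactin (gtop G) ?S" using f by (simp add: groupoid_algebra_iff)
  have "?S \<subseteq> \<Union>?\<U>"
  proof
    fix a assume "a \<in> ?S"
    then have "a \<in> topspace (gtop G)" by (simp add: arrows_topspace)
    then obtain U where "openin (gtop G) U" "a \<in> U" "inj_on (gran G) U"
      by (rule ran_local_section[OF openin_topspace])
    then show "a \<in> \<Union>?\<U>" by blast
  qed
  then obtain \<F> where \<F>: "finite \<F>" "\<F> \<subseteq> ?\<U>" "?S \<subseteq> \<Union>\<F>"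
    using compactinD[OF S, of ?\<U>] by auto
  have "finite {a \<in> U. gran G a = x}" if "U \<in> \<F>" for U
  proof (rule finite_imageD[of "gran G"])
    show "finite (gran G ` {a \<in> U. gran G a = x})"
      by (rule finite_subset[of _ "{x}"]) auto
    have "inj_on (gran G) U" using subsetD[OF \<F>(2) that] by simp
    then show "inj_on (gran G) {a \<in> U. gran G a = x}" by (rule inj_on_subset) (rule Collect_subset)
  qed
  then have "finite (\<Union>U\<in>\<F>. {a \<in> U. gran G a = x})" using \<F>(1) by simp
  moreover have "{a \<in> arrows G. gran G a = x \<and> f a \<noteq> 0} \<subseteq> (\<Union>U\<in>\<F>. {a \<in> U. gran G a = x})"
    using \<F>(3) by blast
  ultimately show ?thesis by (rule finite_subset[rotated])
qed

lemma groupoid_algebra_star: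
  assumes R: "conj_closed_subring R" and f: "f \<in> groupoid_algebra R G"
  shows "star G f \<in> groupoid_algebra R G"
proof (rule groupoid_algebraI)
  show "star G f x \<in> R" if "x \<in> arrows G" for x
    using that f arrows_closed(3)
    by (simp add: star_def groupoid_algebra_iff conj_closed_subring_closed(6)[OF R])
  show "star G f x = 0" if "x \<notin> arrows G" for x using that by (simp add: star_def)
  have "locally_constant_map (gtop G) (\<lambda>x. f (ginv G x))"
    using f by (intro locally_constant_map_compose[OF ginv_continuous]) (simp add: groupoid_algebra_iff)
  then have "locally_constant_map (gtop G) (\<lambda>x. cnj (f (ginv G x)))"
    using locally_constant_map_binop[of _ _ _ "\<lambda>a b. cnj a"] by blast
  \<comment> \<open>The two functions differ only off the arrows, and open sets contain arrows
    only.\<close>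
  then show "locally_constant_map (gtop G) (star G f)"
    unfolding locally_constant_map_def star_def
    by (metis arrows_topspace openin_subset subsetD)
  show "compactin (gtop G) (ginv G ` {x \<in> arrows G. f x \<noteq> 0})"
    using f by (intro image_compactin[OF _ ginv_continuous]) (simp add: groupoid_algebra_iff)
  show "x \<in> ginv G ` {x \<in> arrows G. f x \<noteq> 0}" if "x \<in> arrows G" "star G f x \<noteq> 0" for x
    using that arrows_closed(3) ginv_ginv[OF that(1)]
    by (intro image_eqI[of _ _ "ginv G x"]) (auto simp: star_def)
qed

text \<open>The finitely many arrows contributing at \<gamma> extend along local sections of the
  range map. Near \<gamma> these sections run through exactly the contributing arrows, and each
  summand is locally constant.\<close>

lemma conv_locally_constant:
  assumes f: "f \<in> groupoid_algebra R G" and g: "g \<in> groupoid_algebra R G"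
  shows "locally_constant_map (gtop G) (conv G f g)"
  unfolding locally_constant_map_def
proof
  let ?X = "gtop G" and ?r = "gran G"
  fix \<gamma> assume "\<gamma> \<in> topspace ?X"
  then have \<gamma>: "\<gamma> \<in> arrows G" by (simp add: arrows_topspace)
  define F where "F = {a \<in> arrows G. ?r a = ?r \<gamma> \<and> f a \<noteq> 0}"
  have fin: "finite F" unfolding F_def by (rule finite_fibre_support[OF f])
  have FA: "F \<subseteq> topspace ?X" by (auto simp: F_def arrows_topspace)
  obtain V where V: "\<And>a. a \<in> F \<Longrightarrow> openin ?X (V a)" "\<And>a. a \<in> F \<Longrightarrow> a \<in> V a"
    and disj: "\<And>a b. a \<in> F \<Longrightarrow> b \<in> F \<Longrightarrow> a \<noteq> b \<Longrightarrow> V a \<inter> V b = {}"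
    using Hausdorff_space_finite_separation[OF Hausdorff fin FA] by metis
  have lcf: "locally_constant_map ?X f" and lcg: "locally_constant_map ?X g"
    using f g by (auto simp: groupoid_algebra_iff)
  define P where "P a U s \<longleftrightarrow> openin ?X U \<and> a \<in> U \<and> U \<subseteq> V a \<inter> {y \<in> arrows G. f y = f a} \<and>
      openin ?X {y \<in> arrows G. ?r y \<in> ?r ` U} \<and>
      continuous_map (subtopology ?X {y \<in> arrows G. ?r y \<in> ?r ` U}) ?X (\<lambda>y. s (?r y)) \<and>
      (\<forall>b\<in>U. s (?r b) = b)" for a U s
  have "\<exists>U s. P a U s" if "a \<in> F" for a
  proof -
    have "openin ?X (V a \<inter> {y \<in> arrows G. f y = f a})"
      using V(1)[OF that] locally_constant_map_openin[OF lcf, of "\<lambda>z. z = f a"]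
      by (auto simp: arrows_topspace)
    moreover have "a \<in> V a \<inter> {y \<in> arrows G. f y = f a}"
      using V(2) that by (auto simp: F_def)
    ultimately show ?thesis by (rule ran_local_section) (unfold P_def, blast)
  qed
  then obtain U s where P: "\<And>a. a \<in> F \<Longrightarrow> P a (U a) (s a)" by metis
  have U: "openin ?X (U a)" "a \<in> U a" "U a \<subseteq> V a \<inter> {y \<in> arrows G. f y = f a}"
      "openin ?X {y \<in> arrows G. ?r y \<in> ?r ` U a}"
      "continuous_map (subtopology ?X {y \<in> arrows G. ?r y \<in> ?r ` U a}) ?X (\<lambda>y. s a (?r y))"
      "\<And>b. b \<in> U a \<Longrightarrow> s a (?r b) = b" if "a \<in> F" for a
    using P[OF that] unfolding P_def by simp_all
  define K where "K = {a \<in> arrows G. f a \<noteq> 0} - (\<Union>a\<in>F. U a)"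
  define W where "W = {y \<in> arrows G. (\<forall>a\<in>F. ?r y \<in> ?r ` U a)} \<inter> {y \<in> arrows G. ?r y \<in> arrows G - ?r ` K}"
  have "compactin ?X K"
  proof (rule closed_compactin)
    show "compactin ?X {a \<in> arrows G. f a \<noteq> 0}" using f by (simp add: groupoid_algebra_iff)
    show "closedin ?X K"
      unfolding K_def using locally_constant_map_closedin[OF lcf, of "\<lambda>z. z \<noteq> 0"] U(1)
      by (intro closedin_diff) (auto simp: arrows_topspace)
  qed (auto simp: K_def)
  \<comment> \<open>Compactness of \<open>K\<close> enters here: a compact image in a Hausdorff
    space is closed.\<close>
  then have "closedin ?X (?r ` K)"
    using image_compactin[OF _ ran_continuous] compactin_imp_closedin[OF Hausdorff] by blast
  then have "openin ?X (arrows G - ?r ` K)"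
    by (metis arrows_topspace openin_diff openin_topspace)
  then have "openin ?X {y \<in> arrows G. ?r y \<in> arrows G - ?r ` K}"
    using openin_continuous_map_preimage[OF ran_continuous, of "arrows G - ?r ` K"]
    by (simp add: arrows_topspace)
  moreover have "openin ?X {y \<in> topspace ?X. (\<forall>a\<in>F. ?r y \<in> ?r ` U a)}"
    using U(4) by (intro openin_finite_Ball fin) (simp add: arrows_topspace)
  ultimately have W: "openin ?X W"
    unfolding W_def by (intro openin_Int) (simp_all add: arrows_topspace)
  have "\<gamma> \<in> W"
  proof -
    have "?r \<gamma> \<in> ?r ` U a" if "a \<in> F" for a
      using U(2)[OF that] that by (intro image_eqI[of _ _ a]) (auto simp: F_def)
    moreover have "?r \<gamma> \<notin> ?r ` K"
      using U(2) by (auto simp: K_def F_def)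
    ultimately show ?thesis using \<gamma> arrows_closed(2) by (simp add: W_def)
  qed
  have sU: "s a (?r y) \<in> U a \<and> ?r (s a (?r y)) = ?r y" if "a \<in> F" "y \<in> W" for a y
    using that U(6)[OF that(1)] by (auto simp: W_def)
  have sA: "s a (?r y) \<in> arrows G \<and> f (s a (?r y)) = f a" if "a \<in> F" "y \<in> W" for a y
    using sU[OF that] U(3)[OF that(1)] by auto
  let ?k = "\<lambda>a y. gmult G (ginv G (s a (?r y))) y"
  \<comment> \<open>Over \<open>W\<close> the index set of the sum becomes the fixed finite set
    \<open>F\<close>, with \<open>f\<close> constant along each section.\<close>
  have formula: "conv G f g y = (\<Sum>a\<in>F. f a * g (?k a y))" if y: "y \<in> W" for y
  proof -
    have "{a \<in> arrows G. ?r a = ?r y \<and> f a \<noteq> 0} = (\<lambda>a. s a (?r y)) ` F"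
    proof (intro equalityI subsetI)
      fix b assume b: "b \<in> {a \<in> arrows G. ?r a = ?r y \<and> f a \<noteq> 0}"
      then have rb: "?r b = ?r y" by simp
      have "?r b \<notin> ?r ` K" using y unfolding rb by (simp add: W_def)
      then have "b \<notin> K" by blast
      then obtain a where "a \<in> F" "b \<in> U a" using b by (auto simp: K_def)
      then show "b \<in> (\<lambda>a. s a (?r y)) ` F"
        using U(6)[of a b] b by (intro image_eqI[of _ _ a]) auto
    next
      fix b assume "b \<in> (\<lambda>a. s a (?r y)) ` F"
      then obtain a where "a \<in> F" "b = s a (?r y)" by blast
      then show "b \<in> {a \<in> arrows G. ?r a = ?r y \<and> f a \<noteq> 0}"
        using sU[of a y] sA[of a y] y by (auto simp: F_def)
    qed
    \<comment> \<open>Different sections stay in the disjoint sets \<open>V a\<close>, so no arrow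
      is counted twice.\<close>
    moreover have "inj_on (\<lambda>a. s a (?r y)) F"
    proof (rule inj_onI, rule ccontr)
      fix a b assume ab: "a \<in> F" "b \<in> F" "s a (?r y) = s b (?r y)" "a \<noteq> b"
      have "s a (?r y) \<in> V a" "s b (?r y) \<in> V b"
        using sU[OF ab(1) y] sU[OF ab(2) y] U(3)[OF ab(1)] U(3)[OF ab(2)] by blast+
      then show False using disj[of a b] ab by auto
    qed
    moreover have "y \<in> arrows G" using y by (simp add: W_def)
    ultimately show ?thesis
      using sA y by (simp add: conv_def sum.reindex)
  qed
  have lck: "locally_constant_map (subtopology ?X W) (\<lambda>y. g (?k a y))" if a: "a \<in> F" for a
  proof (rule locally_constant_map_compose[OF _ lcg])
    have "continuous_map (subtopology ?X W) ?X (\<lambda>y. s a (?r y))"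
      using U(5)[OF a] by (rule continuous_map_from_subtopology_mono) (use a in \<open>auto simp: W_def\<close>)
    from continuous_map_compose[OF this ginv_continuous]
    have "continuous_map (subtopology ?X W) ?X (\<lambda>y. ginv G (s a (?r y)))" by (simp add: o_def)
    moreover have "continuous_map (subtopology ?X W) ?X (\<lambda>y. y)"
      using continuous_map_from_subtopology[OF continuous_map_id, of ?X W] by (simp add: id_def)
    ultimately have "continuous_map (subtopology ?X W) (subtopology (prod_topology ?X ?X) (composable G))
        (\<lambda>y. (ginv G (s a (?r y)), y))"
      using sA[OF a] sU[OF a] arrows_closed
      by (intro continuous_map_into_subtopology continuous_map_pairedI)
        (auto simp: composable_def arrows_topspace)
    from continuous_map_compose[OF this mult_continuous]
    show "continuous_map (subtopology ?X W) ?X (?k a)" by (simp add: o_def)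
  qed
  define Z where "Z = {y \<in> topspace (subtopology ?X W). \<forall>a\<in>F. g (?k a y) = g (?k a \<gamma>)}"
  have "openin (subtopology ?X W) Z"
    unfolding Z_def using locally_constant_map_openin[OF lck] fin by (intro openin_finite_Ball) auto
  then have "openin ?X Z" using W openin_trans_full by blast
  moreover have "\<gamma> \<in> Z" using \<open>\<gamma> \<in> W\<close> \<gamma> by (simp add: Z_def arrows_topspace)
  moreover have "conv G f g y = conv G f g \<gamma>" if "y \<in> Z" for y
    using that formula[of y] formula[OF \<open>\<gamma> \<in> W\<close>] by (simp add: Z_def)
  ultimately show "\<exists>U. openin ?X U \<and> \<gamma> \<in> U \<and> (\<forall>y\<in>U. conv G f g y = conv G f g \<gamma>)" by blast
qed

text \<open>The support of the product lies in the image, under multiplication, of the composable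
  pairs from the two supports. These pairs form a compact set because composability is a closed
  condition.\<close>

lemma groupoid_algebra_conv:
  assumes R: "conj_closed_subring R"
    and f: "f \<in> groupoid_algebra R G" and g: "g \<in> groupoid_algebra R G"
  shows "conv G f g \<in> groupoid_algebra R G"
proof (rule groupoid_algebraI)
  let ?X = "gtop G" and ?r = "gran G"
  let ?Sf = "{x \<in> arrows G. f x \<noteq> 0}" and ?Sg = "{x \<in> arrows G. g x \<noteq> 0}"
  show "conv G f g x \<in> R" if "x \<in> arrows G" for x
    using that f g arrows_closed mult_closed(1) unfolding conv_def groupoid_algebra_iff
    by (auto intro!: conj_closed_subring_closed[OF R])
  show "conv G f g x = 0" if "x \<notin> arrows G" for x using that by (simp add: conv_def)
  show "locally_constant_map ?X (conv G f g)" by (rule conv_locally_constant[OF f g])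
  \<comment> \<open>Composable pairs are the equaliser of two continuous maps into a Hausdorff
    space.\<close>
  have "closedin (prod_topology ?X ?X) {p \<in> topspace (prod_topology ?X ?X). gdom G (fst p) = ?r (snd p)}"
    using continuous_map_compose[OF continuous_map_fst dom_continuous]
      continuous_map_compose[OF continuous_map_snd ran_continuous]
    by (intro closedin_continuous_maps_eq[OF Hausdorff]) (auto simp: o_def)
  moreover have "{p \<in> topspace (prod_topology ?X ?X). gdom G (fst p) = ?r (snd p)} = composable G"
    by (auto simp: composable_def arrows_topspace)
  moreover have "compactin (prod_topology ?X ?X) (?Sf \<times> ?Sg)"
    using f g by (simp add: compactin_Times groupoid_algebra_iff)
  ultimately have "compactin (prod_topology ?X ?X) (composable G \<inter> (?Sf \<times> ?Sg))"
    using closed_Int_compactin by fastforce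
  then have "compactin (subtopology (prod_topology ?X ?X) (composable G)) (composable G \<inter> (?Sf \<times> ?Sg))"
    by (simp add: compactin_subtopology)
  then show "compactin ?X ((\<lambda>(a, b). gmult G a b) ` (composable G \<inter> (?Sf \<times> ?Sg)))"
    by (rule image_compactin[OF _ mult_continuous])
  show "x \<in> (\<lambda>(a, b). gmult G a b) ` (composable G \<inter> (?Sf \<times> ?Sg))"
    if x: "x \<in> arrows G" "conv G f g x \<noteq> 0" for x
  proof -
    \<comment> \<open>A nonzero sum has a nonzero term, and its index \<open>a\<close> factors
      \<open>x\<close> as \<open>a\<close> times \<open>?b\<close>, both in the supports.\<close>
    have "(\<Sum>a | a \<in> arrows G \<and> ?r a = ?r x \<and> f a \<noteq> 0. f a * g (gmult G (ginv G a) x)) \<noteq> 0"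
      using x by (simp add: conv_def)
    from sum.not_neutral_contains_not_neutral[OF this]
    obtain a where a: "a \<in> arrows G" "?r a = ?r x" "f a * g (gmult G (ginv G a) x) \<noteq> 0" by blast
    let ?b = "gmult G (ginv G a) x"
    have "?b \<in> arrows G" "?r ?b = gdom G a"
      using mult_closed[of "ginv G a" x] arrows_closed[OF a(1)] a x by auto
    then show ?thesis
      using a mult_ginv_cancel[OF a(1) x(1) a(2)]
      by (intro image_eqI[of _ _ "(a, ?b)"]) (auto simp: composable_def)
  qed
qed

section \<open>Projections and the diagonal subalgebra\<close>

lemma projection_in_diagonal:
  assumes R: "conj_closed_subring R" and triv: "projection_rows_trivial R" and f: "projection R G f"
  shows "f \<in> diagonal R G"
proof -
  have alg: "f \<in> groupoid_algebra R G" and sa: "f = star G f" and idem: "f = conv G f f"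
    using f by (auto simp: projection_def)
  have "b \<in> unit_space G" if "f b \<noteq> 0" for b
  proof (rule ccontr)
    assume nb: "b \<notin> unit_space G"
    have b: "b \<in> arrows G" using alg \<open>f b \<noteq> 0\<close> by (auto simp: groupoid_algebra_iff)
    let ?x = "gran G b"
    let ?F = "{a \<in> arrows G. gran G a = ?x \<and> f a \<noteq> 0}"
    have x: "?x \<in> unit_space G" using ran_in_unit_space b by simp
    have fin: "finite ?F" by (rule finite_fibre_support[OF alg])
    have "f ?x = (\<Sum>a\<in>?F. f a * f (gmult G (ginv G a) ?x))"
      using unit_spaceD[OF x] by (subst idem) (simp add: conv_def)
    also have "\<dots> = (\<Sum>a\<in>?F. complex_of_real ((cmod (f a))\<^sup>2))"
    proof (rule sum.cong)
      fix a assume a: "a \<in> ?F"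
      \<comment> \<open>The unit is absorbed, and self-adjointness turns the value at the inverse
        into a conjugate, so each term is a squared modulus.\<close>
      have "gmult G (ginv G a) ?x = ginv G a"
        using arrows_closed(9,10)[of "ginv G a"] arrows_closed[of a] a by auto
      moreover have "f (ginv G a) = cnj (f a)"
        using fun_cong[OF sa, of a] a by (simp add: star_def)
      ultimately show "f a * f (gmult G (ginv G a) ?x) = complex_of_real ((cmod (f a))\<^sup>2)"
        by (simp add: complex_mult_cnj cmod_power2)
    qed simp
    \<comment> \<open>The row condition needs its distinguished index in the set; if
      \<open>f ?x\<close> is zero, the added term is zero.\<close>
    also have "\<dots> = (\<Sum>a\<in>insert ?x ?F. complex_of_real ((cmod (f a))\<^sup>2))"
      using fin unit_spaceD[OF x] by (intro sum.mono_neutral_left) auto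
    finally have "f ?x = complex_of_real (\<Sum>a\<in>insert ?x ?F. (cmod (f a))\<^sup>2)" by simp
    moreover have "f a \<in> R" if "a \<in> insert ?x ?F" for a
      using that unit_spaceD[OF x] alg by (auto simp: groupoid_algebra_iff)
    moreover have "b \<noteq> ?x" using nb x by metis
    ultimately have "f b = 0"
      using projection_rows_trivialD[OF triv, of "insert ?x ?F" ?x f b] fin b \<open>f b \<noteq> 0\<close> by blast
    then show False using \<open>f b \<noteq> 0\<close> by simp
  qed
  then show ?thesis using alg by (simp add: diagonal_def)
qed

text \<open>Units are their own inverses, and a range fibre contains a single unit, so the
  convolution sum has at most one term.\<close>

lemma projection_indicator:
  assumes R: "conj_closed_subring R"
    and U: "openin (gtop G) U" "compactin (gtop G) U" "U \<subseteq> unit_space G"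
  shows "projection R G (indicator U)"
  unfolding projection_def
proof (intro conjI ext)
  have UA: "U \<subseteq> arrows G" using U unit_spaceD by auto
  have "closedin (gtop G) U" by (rule compactin_imp_closedin[OF Hausdorff U(2)])
  then have "openin (gtop G) (arrows G - U)" by (simp add: closedin_def arrows_topspace)
  then have "locally_constant_map (gtop G) (indicator U :: _ \<Rightarrow> complex)"
    unfolding locally_constant_map_def arrows_topspace
    using U(1) by (metis Diff_iff indicator_simps)
  then show "(indicator U :: _ \<Rightarrow> complex) \<in> groupoid_algebra R G"
    using UA by (intro groupoid_algebraI[OF _ _ _ U(2)])
      (auto simp: indicator_def intro: conj_closed_subring_closed(1,2)[OF R])
  show "indicator U x = star G (indicator U) x" for x
  proof -
    have "ginv G x \<in> U \<longleftrightarrow> x \<in> U" if "x \<in> arrows G"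
      using ginv_unit U(3) ginv_ginv[OF that] by (metis subsetD)
    then show ?thesis using UA by (auto simp: star_def indicator_def)
  qed
  show "indicator U x = conv G (indicator U) (indicator U) x" for x
  proof (cases "x \<in> arrows G")
    case True
    have eq: "{a \<in> arrows G. gran G a = gran G x \<and> indicator U a \<noteq> (0::complex)} =
        (if gran G x \<in> U then {gran G x} else {})"
      using UA U(3) unit_spaceD True arrows_closed by (auto simp: indicator_def)
    have conv: "conv G (indicator U) (indicator U) x = (\<Sum>a\<in>(if gran G x \<in> U then {gran G x} else {}).
        indicator U a * indicator U (gmult G (ginv G a) x))"
      using True by (simp only: conv_def eq if_True)
    have "x \<in> U \<Longrightarrow> gran G x \<in> U" using U(3) unit_spaceD by auto
    moreover have "gmult G (ginv G (gran G x)) x = x"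
      using arrows_closed[OF True] ginv_unit[OF ran_in_unit_space[OF True]] by simp
    ultimately show ?thesis
      by (auto simp: conv indicator_def)
  qed (use UA in \<open>auto simp: conv_def indicator_def\<close>)
qed

text \<open>The sets are the level sets of the nonzero values. There are finitely many of them, and
  each is open, and compact as a closed part of the support.\<close>

lemma diagonal_span:
  assumes f: "f \<in> diagonal R G"
  obtains C U where "finite C" "C \<subseteq> R" "f = (\<lambda>x. \<Sum>c\<in>C. c * indicator (U c) x)"
    "\<forall>c\<in>C. openin (gtop G) (U c) \<and> compactin (gtop G) (U c) \<and> U c \<subseteq> unit_space G"
proof
  let ?S = "{x \<in> arrows G. f x \<noteq> 0}"
  let ?U = "\<lambda>c. {x \<in> arrows G. f x = c}"
  have alg: "f \<in> groupoid_algebra R G" and supp: "\<And>x. f x \<noteq> 0 \<Longrightarrow> x \<in> unit_space G"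
    using f by (auto simp: diagonal_def)
  then have lc: "locally_constant_map (gtop G) f" and S: "compactin (gtop G) ?S"
    by (auto simp: groupoid_algebra_iff)
  show fin: "finite (f ` ?S)" by (rule locally_constant_map_finite_image[OF lc S])
  show "f ` ?S \<subseteq> R" using alg by (auto simp: groupoid_algebra_iff)
  show "f = (\<lambda>x. \<Sum>c\<in>f ` ?S. c * indicator (?U c) x)"
  proof
    fix x
    show "f x = (\<Sum>c\<in>f ` ?S. c * indicator (?U c) x)"
    proof (cases "x \<in> ?S")
      case True
      then have "(\<Sum>c\<in>f ` ?S. c * indicator (?U c) x) = (\<Sum>c\<in>{f x}. c * indicator (?U c) x)"
        using fin by (intro sum.mono_neutral_right) (auto simp: indicator_def)
      then show ?thesis using True by simp
    next
      case False
      then have "f x = 0" using alg by (auto simp: groupoid_algebra_iff)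
      then show ?thesis by (auto simp: indicator_def intro!: sum.neutral[symmetric])
    qed
  qed
  show "\<forall>c\<in>f ` ?S. openin (gtop G) (?U c) \<and> compactin (gtop G) (?U c) \<and> ?U c \<subseteq> unit_space G"
  proof
    fix c assume c: "c \<in> f ` ?S"
    have "compactin (gtop G) (?U c)"
      by (rule closed_compactin[OF S])
        (use c locally_constant_map_closedin[OF lc, of "\<lambda>z. z = c"] in \<open>auto simp: arrows_topspace\<close>)
    then show "openin (gtop G) (?U c) \<and> compactin (gtop G) (?U c) \<and> ?U c \<subseteq> unit_space G"
      using c supp locally_constant_map_openin[OF lc, of "\<lambda>z. z = c"] by (auto simp: arrows_topspace)
  qed
qed

end

section \<open>Star homomorphisms and the diagonal\<close>

lemma star_hom_projection:
  "star_hom R G H \<phi> \<Longrightarrow> projection R G p \<Longrightarrow> projection R H (\<phi> p)"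
  unfolding star_hom_def projection_def by metis

lemma star_hom_diagonal_preserving:
  assumes R: "conj_closed_subring R" and triv: "projection_rows_trivial R"
    and G: "hausdorff_ample_groupoid G" and H: "hausdorff_ample_groupoid H"
    and \<phi>: "star_hom R G H \<phi>"
  shows "diagonal_preserving R G H \<phi>"
  unfolding diagonal_preserving_def
proof (intro image_subsetI)
  interpret G: hausdorff_ample G by unfold_locales (rule G)
  interpret H: hausdorff_ample H by unfold_locales (rule H)
  fix f assume f: "f \<in> diagonal R G"
  then obtain C U where C: "finite C" "C \<subseteq> R" and f_eq: "f = (\<lambda>x. \<Sum>c\<in>C. c * indicator (U c) x)"
    and U: "\<forall>c\<in>C. openin (gtop G) (U c) \<and> compactin (gtop G) (U c) \<and> U c \<subseteq> unit_space G"
    by (rule G.diagonal_span)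
  have proj: "projection R G (indicator (U c))" if "c \<in> C" for c
    using bspec[OF U that] by (intro G.projection_indicator[OF R]) auto
  then have diag: "\<phi> (indicator (U c)) \<in> diagonal R H" if "c \<in> C" for c
    using that star_hom_projection[OF \<phi>] H.projection_in_diagonal[OF R triv] by blast
  have "\<phi> f = (\<lambda>y. \<Sum>c\<in>C. c * \<phi> (indicator (U c)) y)"
    unfolding f_eq using proj C by (intro star_hom_sum[OF R \<phi>]) (auto simp: projection_def)
  then have "\<phi> f y = 0" if "y \<notin> unit_space H" for y
    using diag that by (auto simp: diagonal_def intro!: sum.neutral)
  moreover have "\<phi> f \<in> groupoid_algebra R H"
    using f \<phi> by (simp add: diagonal_def star_hom_def)
  ultimately show "\<phi> f \<in> diagonal R H"
    unfolding diagonal_def by blast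
qed

lemma star_iso_inverse:
  assumes R: "conj_closed_subring R" and G: "hausdorff_ample_groupoid G"
    and iso: "star_iso R G H \<phi>"
  shows "star_hom R H G (inv_into (groupoid_algebra R G) \<phi>)"
proof -
  interpret G: hausdorff_ample G by unfold_locales (rule G)
  let ?A = "groupoid_algebra R G" and ?B = "groupoid_algebra R H"
  let ?\<psi> = "inv_into ?A \<phi>"
  have bij: "bij_betw \<phi> ?A ?B" and hom: "star_hom R G H \<phi>" using iso by (auto simp: star_iso_def)
  have \<psi>: "?\<psi> h \<in> ?A" "\<phi> (?\<psi> h) = h" if "h \<in> ?B" for h
    using bij that by (auto simp: bij_betw_def inv_into_into f_inv_into_f)
  \<comment> \<open>Each law for the inverse reduces to this: the right-hand side lies in the
    algebra of \<open>G\<close>, by closure, and \<open>\<phi>\<close> maps it correctly.\<close>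
  have inv: "?\<psi> h = f" if "f \<in> ?A" "\<phi> f = h" for f h
    using bij that by (auto simp: bij_betw_def)
  note hom' = hom[unfolded star_hom_def]
  show ?thesis
    unfolding star_hom_def
  proof (intro conjI ballI)
    fix h assume h: "h \<in> ?B"
    show "?\<psi> h \<in> ?A" using \<psi> h by blast
    show "?\<psi> (star H h) = star G (?\<psi> h)"
      using \<psi>[OF h] hom' by (intro inv G.groupoid_algebra_star[OF R]) auto
    show "?\<psi> (\<lambda>x. c * h x) = (\<lambda>y. c * ?\<psi> h y)" if "c \<in> R" for c
      using \<psi>[OF h] hom' that by (intro inv groupoid_algebra_scale[OF R]) auto
    fix k assume k: "k \<in> ?B"
    show "?\<psi> (\<lambda>x. h x + k x) = (\<lambda>y. ?\<psi> h y + ?\<psi> k y)"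
      using \<psi>[OF h] \<psi>[OF k] hom' by (intro inv groupoid_algebra_add[OF R]) auto
    show "?\<psi> (conv H h k) = conv G (?\<psi> h) (?\<psi> k)"
      using \<psi>[OF h] \<psi>[OF k] hom' by (intro inv G.groupoid_algebra_conv[OF R]) auto
  qed
qed

lemma star_iso_diagonal_preserving_iso:
  assumes R: "conj_closed_subring R" and triv: "projection_rows_trivial R"
    and G: "hausdorff_ample_groupoid G" and H: "hausdorff_ample_groupoid H"
    and iso: "star_iso R G H \<phi>"
  shows "diagonal_preserving_iso R G H \<phi>"
  using star_hom_diagonal_preserving[OF R triv G H] star_iso_inverse[OF R G iso]
    star_hom_diagonal_preserving[OF R triv H G] iso
  by (auto simp: diagonal_preserving_iso_def star_iso_def)

section \<open>Pair groupoids and matrices\<close>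

text \<open>Two nonzero entries in one row would belong to two orthogonal columns that are both
  supported in that row alone, which is impossible. Unit norm rules out zero rows and
  columns.\<close>

lemma columns_sparse_imp_monomial:
  assumes U: "U \<in> carrier_mat n n" "unitary_mat n U"
    and sparse: "\<And>i j k. i < n \<Longrightarrow> j < n \<Longrightarrow> k < n \<Longrightarrow> U $$ (i, k) \<noteq> 0 \<Longrightarrow> U $$ (j, k) \<noteq> 0 \<Longrightarrow> i = j"
  shows "monomial_mat n U"
proof -
  note adj = mat_adjoint_carrier[OF U(1)] unitary_mat_adjoint[OF U(2)]
  have "k = l" if "i < n" "k < n" "l < n" "U $$ (i, k) \<noteq> 0" "U $$ (i, l) \<noteq> 0" for i k l
  proof (rule ccontr)
    assume "k \<noteq> l"
    then have "(\<Sum>j<n. cnj (U $$ (j, k)) * U $$ (j, l)) = 0"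
      using unitary_mat_rows_orthonormal[OF adj that(2,3)] U that by simp
    moreover have "(\<Sum>j<n. cnj (U $$ (j, k)) * U $$ (j, l)) = (\<Sum>j\<in>{i}. cnj (U $$ (j, k)) * U $$ (j, l))"
      using sparse[OF that(1) _ that(2,4)] that(1) by (intro sum.mono_neutral_right) auto
    ultimately show False using that by simp
  qed
  moreover have "\<exists>i<n. U $$ (i, k) \<noteq> 0" if "k < n" for k
    using unitary_mat_row_nonzero[OF adj that] U that by auto
  ultimately show ?thesis
    using unitary_mat_row_nonzero[OF U] sparse unfolding monomial_mat_def by metis
qed

lemma elements_mat_mult:
  assumes R: "conj_closed_subring R"
    and A: "A \<in> carrier_mat n m" "elements_mat A \<subseteq> R" and B: "B \<in> carrier_mat m l" "elements_mat B \<subseteq> R"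
  shows "elements_mat (A * B) \<subseteq> R"
proof -
  have "A * B \<in> carrier_mat n l" using A B by simp
  moreover have "(A * B) $$ (i, j) \<in> R" if "i < n" "j < l" for i j
    unfolding index_mult_mat_sum[OF A(1) B(1) that]
    using A(2) B(2) that elements_mat_subset_iff[OF A(1)] elements_mat_subset_iff[OF B(1)]
    by (intro conj_closed_subring_closed(5,7)[OF R]) auto
  ultimately show ?thesis by (simp add: elements_mat_subset_iff)
qed

text \<open>The arrow \<open>e (i, j)\<close> goes from \<open>j\<close> to \<open>i\<close>; the algebra of this groupoid is the algebra of
  \<open>n \<times> n\<close> matrices over \<open>R\<close>.\<close>

definition pair_groupoid :: "(nat \<times> nat \<Rightarrow> 'g) \<Rightarrow> nat \<Rightarrow> 'g groupoid" where
  "pair_groupoid e n =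
     \<lparr>gtop = discrete_topology (e ` ({..<n} \<times> {..<n})),
      gdom = (\<lambda>x. e (snd (inv_into UNIV e x), snd (inv_into UNIV e x))),
      gran = (\<lambda>x. e (fst (inv_into UNIV e x), fst (inv_into UNIV e x))),
      gmult = (\<lambda>x y. e (fst (inv_into UNIV e x), snd (inv_into UNIV e y))),
      ginv = (\<lambda>x. e (snd (inv_into UNIV e x), fst (inv_into UNIV e x)))\<rparr>"

text \<open>The theorem concerns groupoids carried by a given type, so index pairs are coded in that
  type by an injection.\<close>

locale pair_embedding =
  fixes e :: "nat \<times> nat \<Rightarrow> 'g" and n :: nat
  assumes inj: "inj e"
begin

abbreviation "G \<equiv> pair_groupoid e n"

lemma inv_e [simp]: "inv_into UNIV e (e p) = p"
  by (rule inv_f_f[OF inj])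

lemma e_eq_iff [simp]: "e p = e q \<longleftrightarrow> p = q"
  by (rule inj_eq[OF inj])

lemma pair_groupoid_simps [simp]:
  "gtop G = discrete_topology (e ` ({..<n} \<times> {..<n}))"
  "gdom G (e (i, j)) = e (j, j)" "gran G (e (i, j)) = e (i, i)"
  "gmult G (e (i, j)) (e (k, l)) = e (i, l)" "ginv G (e (i, j)) = e (j, i)"
  by (simp_all add: pair_groupoid_def)

lemma arrows_pair: "arrows G = e ` ({..<n} \<times> {..<n})"
  by (simp add: arrows_def)

lemma e_in_arrows [simp]: "e (i, j) \<in> arrows G \<longleftrightarrow> i < n \<and> j < n"
  by (auto simp: arrows_pair)

lemma arrowsE:
  assumes "x \<in> arrows G"
  obtains i j where "i < n" "j < n" "x = e (i, j)"
  using assms by (auto simp: arrows_pair)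

lemma e_in_unit_space: "e (i, j) \<in> unit_space G \<longleftrightarrow> i < n \<and> i = j"
  by (force simp: unit_space_def arrows_pair image_iff)

lemma unit_space_subset: "unit_space G \<subseteq> arrows G"
  by (auto simp: unit_space_def arrows_pair)

lemma is_groupoid_pair: "is_groupoid G"
  unfolding is_groupoid_def composable_def
  by (auto simp: arrows_pair)

text \<open>Everything is discrete, so singletons serve as the neighbourhoods on which the range map
  is a homeomorphism.\<close>

lemma hausdorff_ample_pair: "hausdorff_ample_groupoid G"
proof -
  have unit_top: "unit_top G = discrete_topology (unit_space G)"
    using unit_space_subset by (simp add: unit_top_def inf.absorb2 flip: arrows_pair)
  have "continuous_map (subtopology (prod_topology (gtop G) (gtop G)) (composable G)) (gtop G)
      (\<lambda>(a, b). gmult G a b)"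
    by (auto simp: arrows_pair composable_def simp flip: prod_topology_discrete_topology)
  moreover have "continuous_map (gtop G) (gtop G) (ginv G)"
    by auto
  ultimately have "topological_groupoid G"
    by (simp add: topological_groupoid_def is_groupoid_pair)
  moreover have "local_homeomorphism (gtop G) (unit_top G) (gran G)"
    unfolding local_homeomorphism_def
  proof
    fix x assume "x \<in> topspace (gtop G)"
    then obtain i j where x: "i < n" "j < n" "x = e (i, j)" by auto
    have "openin (gtop G) {x}" "openin (unit_top G) (gran G ` {x})"
      using x by (auto simp: unit_top e_in_unit_space)
    moreover have "subtopology (gtop G) {x} = discrete_topology {x}"
      "subtopology (unit_top G) (gran G ` {x}) = discrete_topology (gran G ` {x})"
      using x by (auto simp: unit_top e_in_unit_space intro!: arg_cong[of _ _ discrete_topology])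
    moreover have "homeomorphic_map (discrete_topology {x}) (discrete_topology (gran G ` {x})) (gran G)"
      by (auto simp: homeomorphic_eq_everything_map open_map_def closed_map_def)
    ultimately show "\<exists>U. openin (gtop G) U \<and> x \<in> U \<and> openin (unit_top G) (gran G ` U) \<and>
        homeomorphic_map (subtopology (gtop G) U) (subtopology (unit_top G) (gran G ` U)) (gran G)"
      by (intro exI[of _ "{x}"]) simp
  qed
  moreover have "totally_disconnected_space (unit_top G)"
    unfolding totally_disconnected_space_def unit_top connectedin_discrete_topology by auto
  ultimately show ?thesis
    by (simp add: hausdorff_ample_groupoid_def ample_groupoid_def unit_top
        locally_compact_space_discrete_topology)
qed

text \<open>On a finite discrete space local constancy and compact support hold for every
  function.\<close>

lemma groupoid_algebra_pair:
  "f \<in> groupoid_algebra R G \<longleftrightarrow> (\<forall>i<n. \<forall>j<n. f (e (i, j)) \<in> R) \<and> (\<forall>x. x \<notin> arrows G \<longrightarrow> f x = 0)"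
proof -
  have "locally_constant_map (gtop G) f"
    unfolding locally_constant_map_def
  proof
    fix x assume "x \<in> topspace (gtop G)"
    then show "\<exists>U. openin (gtop G) U \<and> x \<in> U \<and> (\<forall>y\<in>U. f y = f x)"
      by (intro exI[of _ "{x}"]) auto
  qed
  moreover have "compactin (gtop G) (gtop G closure_of {x \<in> arrows G. f x \<noteq> 0})"
    by (auto simp: compactin_discrete_topology discrete_topology_closure_of arrows_pair)
  ultimately show ?thesis
    by (auto simp: groupoid_algebra_def arrows_pair)
qed

definition mat_of :: "('g \<Rightarrow> complex) \<Rightarrow> complex mat" where
  "mat_of f = mat n n (\<lambda>p. f (e p))"

definition fun_of :: "complex mat \<Rightarrow> 'g \<Rightarrow> complex" where
  "fun_of A = (\<lambda>x. if x \<in> arrows G then A $$ (inv_into UNIV e x) else 0)"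

lemma mat_of_carrier [simp]: "mat_of f \<in> carrier_mat n n"
  and dim_mat_of [simp]: "dim_row (mat_of f) = n" "dim_col (mat_of f) = n"
  and index_mat_of [simp]: "i < n \<Longrightarrow> j < n \<Longrightarrow> mat_of f $$ (i, j) = f (e (i, j))"
  by (auto simp: mat_of_def)

lemma mat_of_fun_of [simp]: "A \<in> carrier_mat n n \<Longrightarrow> mat_of (fun_of A) = A"
  by (rule eq_matI) (auto simp: fun_of_def)

lemma fun_of_mat_of:
  assumes "f \<in> groupoid_algebra R G"
  shows "fun_of (mat_of f) = f"
proof
  fix x show "fun_of (mat_of f) x = f x"
    using assms by (cases "x \<in> arrows G") (auto simp: fun_of_def groupoid_algebra_pair elim!: arrowsE)
qed

lemma fun_of_in_algebra:
  assumes "A \<in> carrier_mat n n"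
  shows "fun_of A \<in> groupoid_algebra R G \<longleftrightarrow> elements_mat A \<subseteq> R"
  unfolding groupoid_algebra_pair elements_mat_subset_iff[OF assms] by (auto simp: fun_of_def)

lemma elements_mat_of:
  "f \<in> groupoid_algebra R G \<Longrightarrow> elements_mat (mat_of f) \<subseteq> R"
  by (auto simp: groupoid_algebra_pair elements_mat_subset_iff[OF mat_of_carrier])

text \<open>Arrows with the range of \<open>e (i, j)\<close> are the \<open>e (i, k)\<close>, and
  the inverse of \<open>e (i, k)\<close> times \<open>e (i, j)\<close> is \<open>e (k, j)\<close>;
  this is the row-by-column rule.\<close>

lemma conv_pair:
  "conv G f g = fun_of (mat_of f * mat_of g)"
proof
  fix x
  show "conv G f g x = fun_of (mat_of f * mat_of g) x"
  proof (cases "x \<in> arrows G")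
    case True
    then obtain i j where ij: "i < n" "j < n" and x: "x = e (i, j)" by (rule arrowsE)
    have eq: "{a \<in> arrows G. gran G a = gran G x \<and> f a \<noteq> 0} = (\<lambda>k. e (i, k)) ` {k. k < n \<and> f (e (i, k)) \<noteq> 0}"
      using ij by (auto simp: x elim!: arrowsE)
    have "conv G f g x = (\<Sum>a\<in>(\<lambda>k. e (i, k)) ` {k. k < n \<and> f (e (i, k)) \<noteq> 0}. f a * g (gmult G (ginv G a) x))"
      using True by (simp only: conv_def eq if_True)
    also have "\<dots> = (\<Sum>k | k < n \<and> f (e (i, k)) \<noteq> 0. f (e (i, k)) * g (e (k, j)))"
      by (subst sum.reindex) (auto simp: inj_on_def x)
    \<comment> \<open>The indices left out by the support restriction in \<open>conv\<close>
      contribute zero.\<close>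
    also have "\<dots> = (\<Sum>k<n. f (e (i, k)) * g (e (k, j)))"
      by (intro sum.mono_neutral_left) auto
    also have "\<dots> = (mat_of f * mat_of g) $$ (i, j)"
      by (subst index_mult_mat_sum[of _ n n _ n]) (use ij in auto)
    finally show ?thesis using ij by (simp add: fun_of_def x)
  qed (simp add: conv_def fun_of_def)
qed

lemma star_pair: "star G f = fun_of (mat_adjoint (mat_of f))"
proof
  fix x show "star G f x = fun_of (mat_adjoint (mat_of f)) x"
    by (cases "x \<in> arrows G") (auto simp: star_def fun_of_def elim!: arrowsE)
qed

lemma diagonal_pair:
  assumes "f \<in> diagonal R G" "i < n" "j < n" "i \<noteq> j"
  shows "f (e (i, j)) = 0"
  using assms by (auto simp: diagonal_def e_in_unit_space)

lemma projections_diagonal_imp_sparse: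
  assumes R: "conj_closed_subring R" and diag: "\<And>f. projection R G f \<Longrightarrow> f \<in> diagonal R G"
    and v: "\<And>k. k < n \<Longrightarrow> v k \<in> R" and unit: "(\<Sum>k<n. (cmod (v k))\<^sup>2) = 1"
    and ij: "i < n" "j < n" "v i \<noteq> 0" "v j \<noteq> 0"
  shows "j = i"
proof (rule ccontr)
  assume "j \<noteq> i"
  \<comment> \<open>The projection onto the line spanned by \<open>v\<close>; its off-diagonal entry
    \<open>(i, j)\<close> vanishes only if \<open>v i\<close> or \<open>v j\<close> does.\<close>
  define A where "A = mat n n (\<lambda>(i, j). v i * cnj (v j))"
  have A: "A \<in> carrier_mat n n" by (simp add: A_def)
  have "elements_mat A \<subseteq> R"
    unfolding elements_mat_subset_iff[OF A]
    using v by (auto simp: A_def intro!: conj_closed_subring_closed(5,6)[OF R])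
  then have "fun_of A \<in> groupoid_algebra R G" by (simp add: fun_of_in_algebra[OF A])
  moreover have "mat_adjoint A = A" by (rule eq_matI) (auto simp: A_def)
  moreover have "A * A = A"
  proof (rule eq_matI)
    fix i j assume "i < dim_row A" "j < dim_col A"
    then have ij: "i < n" "j < n" using A by auto
    have "(A * A) $$ (i, j) = (\<Sum>k<n. v i * cnj (v j) * (v k * cnj (v k)))"
      using ij by (subst index_mult_mat_sum[OF A A]) (auto simp: A_def mult_ac intro!: sum.cong)
    also have "\<dots> = v i * cnj (v j) * complex_of_real (\<Sum>k<n. (cmod (v k))\<^sup>2)"
      by (simp only: of_real_sum complex_norm_square sum_distrib_left)
    finally show "(A * A) $$ (i, j) = A $$ (i, j)" using ij by (simp add: unit A_def)
  qed (use A in auto)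
  ultimately have "projection R G (fun_of A)"
    using A by (simp add: projection_def star_pair conv_pair)
  then have "fun_of A (e (i, j)) = 0" using diag diagonal_pair ij \<open>j \<noteq> i\<close> by blast
  then show False using ij by (simp add: fun_of_def A_def)
qed

end

section \<open>Conjugation by a unitary matrix\<close>

lemma unitary_conjugation_mult:
  assumes U: "U \<in> carrier_mat n n" "unitary_mat n U" and A: "A \<in> carrier_mat n n" and B: "B \<in> carrier_mat n n"
  shows "(U * A * mat_adjoint U) * (U * B * mat_adjoint U) = U * (A * B) * mat_adjoint U"
proof -
  let ?V = "mat_adjoint U"
  have V: "?V \<in> carrier_mat n n" using U by simp
  have "(U * A * ?V) * (U * B * ?V) = U * A * (?V * (U * (B * ?V)))"
    using U A B V by (simp add: assoc_mult_mat[of _ n n _ n _ n] mult_carrier_mat[of _ n n _ n])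
  also have "?V * (U * (B * ?V)) = (?V * U) * (B * ?V)"
    using U B V by (simp add: assoc_mult_mat[of _ n n _ n _ n] mult_carrier_mat[of _ n n _ n])
  also have "\<dots> = B * ?V"
    using U B V by (simp add: unitary_mat_def)
  finally show ?thesis
    using U A B V by (simp add: assoc_mult_mat[of _ n n _ n _ n] mult_carrier_mat[of _ n n _ n])
qed

lemma unitary_conjugation_inverse:
  assumes U: "U \<in> carrier_mat n n" "unitary_mat n U" and A: "A \<in> carrier_mat n n"
  shows "mat_adjoint U * (U * A * mat_adjoint U) * U = A"
proof -
  let ?V = "mat_adjoint U"
  have V: "?V \<in> carrier_mat n n" using U by simp
  have "?V * (U * A * ?V) * U = (?V * U) * A * (?V * U)"
    using U A V by (simp add: assoc_mult_mat[of _ n n _ n _ n] mult_carrier_mat[of _ n n _ n])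
  then show ?thesis using U A by (simp add: unitary_mat_def)
qed

text \<open>Two embeddings occur because source and target may live on different types, though both
  algebras are the same matrix algebra.\<close>

locale unitary_conjugation = G: pair_embedding e n + H: pair_embedding e' n
  for e :: "nat \<times> nat \<Rightarrow> 'g" and e' :: "nat \<times> nat \<Rightarrow> 'h" and n :: nat +
  fixes R :: "complex set" and U :: "complex mat"
  assumes R: "conj_closed_subring R" and U: "U \<in> carrier_mat n n" "elements_mat U \<subseteq> R" "unitary_mat n U"
begin

definition conjugation :: "('g \<Rightarrow> complex) \<Rightarrow> 'h \<Rightarrow> complex" where
  "conjugation f = H.fun_of (U * G.mat_of f * mat_adjoint U)"

lemma adjoint_carrier: "mat_adjoint U \<in> carrier_mat n n"
  using U by simp

lemma conjugated_carrier: "U * G.mat_of f * mat_adjoint U \<in> carrier_mat n n"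
  by (intro mult_carrier_mat[of _ n n] U(1) G.mat_of_carrier adjoint_carrier)

lemma mat_of_conjugation [simp]: "H.mat_of (conjugation f) = U * G.mat_of f * mat_adjoint U"
  by (simp add: conjugation_def conjugated_carrier)

lemma conjugation_in_algebra:
  assumes "f \<in> groupoid_algebra R G.G"
  shows "conjugation f \<in> groupoid_algebra R H.G"
  unfolding conjugation_def H.fun_of_in_algebra[OF conjugated_carrier]
  by (intro elements_mat_mult[OF R, of _ n n _ n] mult_carrier_mat[of _ n n] U(1,2) G.mat_of_carrier
      G.elements_mat_of[OF assms] adjoint_carrier elements_mat_adjoint[OF R U(1,2)])

lemma conjugation_star_hom: "star_hom R G.G H.G conjugation"
  unfolding star_hom_def
proof (intro conjI ballI)
  note V = adjoint_carrier
  fix f assume f: "f \<in> groupoid_algebra R G.G"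
  show "conjugation f \<in> groupoid_algebra R H.G" by (rule conjugation_in_algebra[OF f])
  show "conjugation (star G.G f) = star H.G (conjugation f)"
  proof -
    have "mat_adjoint (U * G.mat_of f * mat_adjoint U) = U * mat_adjoint (G.mat_of f) * mat_adjoint U"
      using U(1) V by (simp add: mat_adjoint_mult[of _ n n _ n] assoc_mult_mat[of _ n n _ n _ n] mult_carrier_mat[of _ n n _ n])
    then show ?thesis
      unfolding H.star_pair mat_of_conjugation unfolding conjugation_def by (simp add: G.star_pair)
  qed
  show "conjugation (\<lambda>x. c * f x) = (\<lambda>y. c * conjugation f y)" for c
  proof -
    have "G.mat_of (\<lambda>x. c * f x) = c \<cdot>\<^sub>m G.mat_of f" by (rule eq_matI) auto
    then have "U * G.mat_of (\<lambda>x. c * f x) * mat_adjoint U = c \<cdot>\<^sub>m (U * G.mat_of f * mat_adjoint U)"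
      using U(1) V by (simp add: mult_smult_distrib[of _ n n _ n] mult_smult_assoc_mat[of _ n n _ n])
    then show ?thesis
      using U(1) by (auto simp: conjugation_def H.fun_of_def fun_eq_iff elim!: H.arrowsE)
  qed
  fix g assume g: "g \<in> groupoid_algebra R G.G"
  show "conjugation (\<lambda>x. f x + g x) = (\<lambda>y. conjugation f y + conjugation g y)"
  proof -
    have "G.mat_of (\<lambda>x. f x + g x) = G.mat_of f + G.mat_of g" by (rule eq_matI) auto
    then have "U * G.mat_of (\<lambda>x. f x + g x) * mat_adjoint U =
        U * G.mat_of f * mat_adjoint U + U * G.mat_of g * mat_adjoint U"
      using U(1) V by (simp add: mult_add_distrib_mat[of _ n n _ n] add_mult_distrib_mat[of _ n n _ _ n])
    then show ?thesis
      using U(1) by (auto simp: conjugation_def H.fun_of_def fun_eq_iff elim!: H.arrowsE)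
  qed
  show "conjugation (conv G.G f g) = conv H.G (conjugation f) (conjugation g)"
    unfolding H.conv_pair mat_of_conjugation
    unfolding conjugation_def
    using unitary_conjugation_mult[OF U(1,3) G.mat_of_carrier G.mat_of_carrier, of f g]
    by (simp add: G.conv_pair mult_carrier_mat[of _ n n _ n])
qed

text \<open>The image of the \<open>k\<close>-th diagonal matrix unit is column \<open>k\<close> of
  \<open>U\<close> times its adjoint. If that matrix is diagonal, the column has at most one nonzero
  entry.\<close>

lemma diagonal_preserving_imp_monomial:
  assumes diag: "diagonal_preserving R G.G H.G conjugation"
  shows "monomial_mat n U"
proof (rule columns_sparse_imp_monomial[OF U(1,3)], rule ccontr)
  fix i j k assume ijk: "i < n" "j < n" "k < n" "U $$ (i, k) \<noteq> 0" "U $$ (j, k) \<noteq> 0" "i \<noteq> j"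
  define f :: "'g \<Rightarrow> complex" where "f = indicator {e (k, k)}"
  have "f \<in> diagonal R G.G"
    using ijk conj_closed_subring_closed(1,2)[OF R]
    by (auto simp: f_def diagonal_def G.groupoid_algebra_pair G.e_in_unit_space indicator_def)
  then have "conjugation f \<in> diagonal R H.G" using diag by (auto simp: diagonal_preserving_def)
  then have "conjugation f (e' (i, j)) = 0" using H.diagonal_pair ijk by blast
  moreover have "conjugation f (e' (i, j)) = (U * G.mat_of f * mat_adjoint U) $$ (i, j)"
    using ijk by (simp add: conjugation_def H.fun_of_def)
  moreover have "\<dots> = (\<Sum>a<n. (\<Sum>b<n. U $$ (i, b) * f (e (b, a))) * cnj (U $$ (j, a)))"
    using ijk U(1) adjoint_carrier by (simp add: index_mult_mat_sum[of _ n n _ n] del: index_mult_mat(1))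
  moreover have "\<dots> = (\<Sum>a<n. if a = k then U $$ (i, k) * cnj (U $$ (j, k)) else 0)"
  proof (rule sum.cong[OF refl])
    fix a
    have "(\<Sum>b<n. U $$ (i, b) * f (e (b, a))) = (\<Sum>b<n. if b = k then (if a = k then U $$ (i, k) else 0) else 0)"
      by (intro sum.cong) (auto simp: f_def indicator_def)
    also have "\<dots> = (if a = k then U $$ (i, k) else 0)" using ijk by simp
    finally show "(\<Sum>b<n. U $$ (i, b) * f (e (b, a))) * cnj (U $$ (j, a)) =
        (if a = k then U $$ (i, k) * cnj (U $$ (j, k)) else 0)" by simp
  qed
  ultimately have "U $$ (i, k) * cnj (U $$ (j, k)) = 0" using ijk by simp
  then show False using ijk by simp
qed

end

text \<open>The inverse map is conjugation by the adjoint in the opposite direction, an instance of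
  the same locale with the embeddings exchanged.\<close>

lemma (in unitary_conjugation) conjugation_star_iso: "star_iso R G.G H.G conjugation"
proof -
  interpret inverse: unitary_conjugation e' e n R "mat_adjoint U"
    using R U elements_mat_adjoint[OF R U(1,2)] unitary_mat_adjoint[OF U(3)] by unfold_locales auto
  have "inverse.conjugation (conjugation f) = f" if "f \<in> groupoid_algebra R G.G" for f
    unfolding inverse.conjugation_def mat_of_conjugation mat_adjoint_mat_adjoint
    using unitary_conjugation_inverse[OF U(1,3) G.mat_of_carrier] G.fun_of_mat_of[OF that] by simp
  moreover have "conjugation (inverse.conjugation f) = f" if "f \<in> groupoid_algebra R H.G" for f
    unfolding conjugation_def inverse.mat_of_conjugation
    using unitary_conjugation_inverse[OF inverse.U(1,3) H.mat_of_carrier] H.fun_of_mat_of[OF that] by simp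
  ultimately have "bij_betw conjugation (groupoid_algebra R G.G) (groupoid_algebra R H.G)"
    by (intro bij_betw_byWitness[where f'="inverse.conjugation"])
      (auto intro: conjugation_in_algebra inverse.conjugation_in_algebra)
  then show ?thesis using conjugation_star_hom by (simp add: star_iso_def)
qed

section \<open>From groupoid conditions back to vectors and matrices\<close>

lemma infinite_imp_inj_prod:
  assumes "infinite (UNIV :: 'a set)"
  obtains e :: "nat \<times> nat \<Rightarrow> 'a" where "inj e"
proof -
  obtain h :: "nat \<Rightarrow> 'a" where "inj h" using infinite_countable_subset[OF assms] by blast
  then have "inj (h \<circ> prod_encode)" by (intro inj_compose) (auto simp: inj_prod_encode)
  then show thesis by (rule that)
qed

text \<open>The premise asks for isomorphisms to preserve the diagonal in the forward direction
  only, so the condition on homomorphisms and the one on isomorphisms both supply it.\<close>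

lemma star_isos_diagonal_imp_unitaries_monomial:
  fixes R :: "complex set"
  assumes R: "conj_closed_subring R"
    and "infinite (UNIV :: 'g set)" and "infinite (UNIV :: 'h set)"
    and diag: "\<And>(G :: 'g groupoid) (H :: 'h groupoid) \<phi>. hausdorff_ample_groupoid G \<Longrightarrow>
      hausdorff_ample_groupoid H \<Longrightarrow> star_iso R G H \<phi> \<Longrightarrow> diagonal_preserving R G H \<phi>"
  shows "unitaries_monomial R"
  unfolding unitaries_monomial_def
proof (intro allI impI ballI)
  fix n U assume "U \<in> GL_over R n" and unit: "unitary_mat n U"
  then have U: "U \<in> carrier_mat n n" "elements_mat U \<subseteq> R" by (auto simp: GL_over_def)
  obtain e :: "nat \<times> nat \<Rightarrow> 'g" where e: "inj e" using infinite_imp_inj_prod[OF assms(2)] .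
  obtain e' :: "nat \<times> nat \<Rightarrow> 'h" where e': "inj e'" using infinite_imp_inj_prod[OF assms(3)] .
  interpret unitary_conjugation e e' n R U
    by unfold_locales (fact e e' R U unit)+
  show "monomial_mat n U"
    by (intro diagonal_preserving_imp_monomial diag G.hausdorff_ample_pair H.hausdorff_ample_pair
        conjugation_star_iso)
qed

lemma projections_diagonal_imp_unit_vectors_trivial:
  fixes R :: "complex set"
  assumes R: "conj_closed_subring R" and "infinite (UNIV :: 'g set)"
    and diag: "\<And>(G :: 'g groupoid) f. hausdorff_ample_groupoid G \<Longrightarrow> projection R G f \<Longrightarrow> f \<in> diagonal R G"
  shows "unit_vectors_trivial R"
proof (rule unit_vectors_trivialI)
  fix n i j and v :: "nat \<Rightarrow> complex"
  assume v: "\<And>k. k < n \<Longrightarrow> v k \<in> R" "(\<Sum>k<n. (cmod (v k))\<^sup>2) = 1" "i < n" "j < n" "v i \<noteq> 0" "v j \<noteq> 0"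
  obtain e :: "nat \<times> nat \<Rightarrow> 'g" where e: "inj e" using infinite_imp_inj_prod[OF assms(2)] .
  interpret pair_embedding e n by unfold_locales (fact e)
  show "j = i"
    by (rule projections_diagonal_imp_sparse[OF R diag[OF hausdorff_ample_pair] v])
qed

lemma all_equivalent_six:
  assumes "A \<longleftrightarrow> B" "A \<longleftrightarrow> F" "B \<Longrightarrow> C" "C \<Longrightarrow> A" "B \<Longrightarrow> D" "D \<Longrightarrow> F" "B \<Longrightarrow> E" "E \<Longrightarrow> F"
  shows "all_equivalent [A, B, C, D, E, F]"
proof -
  have "B = A" "C = A" "D = A" "E = A" "F = A" using assms by metis+
  then show ?thesis by (simp add: all_equivalent_def)
qed

theorem theorem2:
  fixes R :: "complex set"
  assumes "conj_closed_subring R"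
    and "infinite (UNIV :: 'g set)"
    and "infinite (UNIV :: 'h set)"
  shows "all_equivalent
    [\<forall>n\<ge>1. \<forall>r :: nat \<Rightarrow> complex. (\<forall>i\<in>{1..n}. r i \<in> R) \<and> (\<Sum>i=1..n. (cmod (r i))\<^sup>2) = 1 \<longrightarrow>
       (\<exists>!i. i \<in> {1..n} \<and> r i \<noteq> 0),
     \<forall>n\<ge>1. \<forall>r :: nat \<Rightarrow> complex. (\<forall>i\<in>{1..n}. r i \<in> R) \<and>
       r 1 = complex_of_real (\<Sum>i=1..n. (cmod (r i))\<^sup>2) \<longrightarrow> (\<forall>i\<in>{2..n}. r i = 0),
     \<forall>G :: 'g groupoid. hausdorff_ample_groupoid G \<longrightarrow>
       (\<forall>f. projection R G f \<longrightarrow> f \<in> diagonal R G),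
     \<forall>(G :: 'g groupoid) (H :: 'h groupoid).
       hausdorff_ample_groupoid G \<and> hausdorff_ample_groupoid H \<longrightarrow>
       (\<forall>\<phi>. star_hom R G H \<phi> \<longrightarrow> diagonal_preserving R G H \<phi>),
     \<forall>(G :: 'g groupoid) (H :: 'h groupoid).
       hausdorff_ample_groupoid G \<and> hausdorff_ample_groupoid H \<longrightarrow>
       (\<forall>\<phi>. star_iso R G H \<phi> \<longrightarrow> diagonal_preserving_iso R G H \<phi>),
     \<forall>n\<ge>1. \<forall>U \<in> GL_over R n. unitary_mat n U \<longrightarrow> monomial_mat n U]"
proof -
  note R = assms(1)
  let ?P3 = "\<forall>G :: 'g groupoid. hausdorff_ample_groupoid G \<longrightarrow>
      (\<forall>f. projection R G f \<longrightarrow> f \<in> diagonal R G)"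
  let ?P4 = "\<forall>(G :: 'g groupoid) (H :: 'h groupoid).
      hausdorff_ample_groupoid G \<and> hausdorff_ample_groupoid H \<longrightarrow>
      (\<forall>\<phi>. star_hom R G H \<phi> \<longrightarrow> diagonal_preserving R G H \<phi>)"
  let ?P5 = "\<forall>(G :: 'g groupoid) (H :: 'h groupoid).
      hausdorff_ample_groupoid G \<and> hausdorff_ample_groupoid H \<longrightarrow>
      (\<forall>\<phi>. star_iso R G H \<phi> \<longrightarrow> diagonal_preserving_iso R G H \<phi>)"
  have 12: "unit_vectors_trivial R \<longleftrightarrow> projection_rows_trivial R"
    using unit_vectors_trivial_imp_projection_rows_trivial[OF R]
      projection_rows_trivial_imp_unit_vectors_trivial[OF R] by blast
  have 16: "unit_vectors_trivial R \<longleftrightarrow> unitaries_monomial R"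
    using unit_vectors_trivial_imp_unitaries_monomial[OF R]
      unitaries_monomial_imp_unit_vectors_trivial[OF R] by blast
  have 23: ?P3 if "projection_rows_trivial R"
    using hausdorff_ample.projection_in_diagonal[OF hausdorff_ample.intro R that] by blast
  have 31: "unit_vectors_trivial R" if ?P3
    by (rule projections_diagonal_imp_unit_vectors_trivial[OF R assms(2)]) (use that in blast)
  have 24: ?P4 if "projection_rows_trivial R"
    using star_hom_diagonal_preserving[OF R that] by blast
  have 46: "unitaries_monomial R" if ?P4
    by (rule star_isos_diagonal_imp_unitaries_monomial[OF R assms(2,3)])
      (use that in \<open>auto simp: star_iso_def\<close>)
  have 25: ?P5 if "projection_rows_trivial R"
    using star_iso_diagonal_preserving_iso[OF R that] by blast
  have 56: "unitaries_monomial R" if ?P5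
    by (rule star_isos_diagonal_imp_unitaries_monomial[OF R assms(2,3)])
      (use that in \<open>auto simp: diagonal_preserving_iso_def\<close>)
  have "all_equivalent [unit_vectors_trivial R, projection_rows_trivial R, ?P3, ?P4, ?P5, unitaries_monomial R]"
    by (rule all_equivalent_six[OF 12 16 23 31 24 46 25 56])
  then show ?thesis
    unfolding unit_vectors_trivial_def projection_rows_trivial_def unitaries_monomial_def .
qed

end
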